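(* Let $X$ be a compact subset of $[0,1]$ with $a=\inf X$ and $b=\sup X$. Suppose that $\phi,\psi:Q\to C(X,Q)$ are two unital monomorphisms. Then $\phi$ and $\psi$ are approximately unitarily equivalent, i.e. there is a sequence of unitaries $u_n\in C(X,Q)$ with $\lim_n u_n^*\phi(x)u_n=\psi(x)$ for all $x\in Q$. Moreover, if $\pi_a\circ\phi=\pi_a\circ\psi$ (or $\pi_b\circ\phi=\pi_b\circ\psi$, or both hold), then there exists a sequence of unitaries $\{u_n\}\subset C(X,Q)$ such that $\pi_a(u_n)=1$ (respectively $\pi_b(u_n)=1$, or $\pi_a(u_n)=\pi_b(u_n)=1$) and $$\lim_{n\to\infty} u_n^*\phi(x)u_n=\psi(x)\quad\text{for all } x\in Q.$$ Furthermore, if $F\subset Q$ is a unital $C^*$-subalgebra which is a full matrix algebra, and $\pi_a\circ\phi|_F=\pi_a\circ\psi|_F$ and $\pi_b\circ\phi|_F=\pi_b\circ\psi|_F$, then for each $\epsilon>0$ there is a unitary $u\in C(X,Q)$ with $\pi_a(u)=\pi_b(u)=1$ and $$\|u^*\phi(f)u-\psi(f)\|<\epsilon\quad\text{for all } f\in F.$$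
   Context: $Q$ denotes the UHF-algebra with $(K_0(Q),K_0(Q)_+,[1_Q])=(\mathbb{Q},\mathbb{Q}_+,1)$. For $t\in X$, $\pi_t:C(X,Q)\to Q$ is the point evaluation $\pi_t(f)=f(t)$. *)

theory Defs
  imports "HOL-Analysis.Analysis" "Jordan_Normal_Form.Matrix"
begin

class cstar_algebra_1 = real_normed_algebra_1 + banach +
  fixes scaleC :: "complex \<Rightarrow> 'a \<Rightarrow> 'a" (infixr "*\<^sub>C" 75)
    and cstar :: "'a \<Rightarrow> 'a"
  assumes scaleC_add_right: "scaleC c (x + y) = scaleC c x + scaleC c y"
    and scaleC_add_left: "scaleC (c + d) x = scaleC c x + scaleC d x"
    and scaleC_scaleC: "scaleC c (scaleC d x) = scaleC (c * d) x"
    and scaleC_one: "scaleC 1 x = x"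
    and scaleR_scaleC: "scaleR r x = scaleC (complex_of_real r) x"
    and scaleC_mult_left: "scaleC c x * y = scaleC c (x * y)"
    and scaleC_mult_right: "x * scaleC c y = scaleC c (x * y)"
    and norm_scaleC: "norm (scaleC c x) = cmod c * norm x"
    and cstar_cstar: "cstar (cstar x) = x"
    and cstar_add: "cstar (x + y) = cstar x + cstar y"
    and cstar_scaleC: "cstar (scaleC c x) = scaleC (cnj c) (cstar x)"
    and cstar_mult: "cstar (x * y) = cstar y * cstar x"
    and cstar_identity: "norm (cstar x * x) = (norm x)\<^sup>2"

definition unital_star_hom :: "('a::cstar_algebra_1 \<Rightarrow> 'b::cstar_algebra_1) \<Rightarrow> bool" where
  "unital_star_hom h \<longleftrightarrow>
     (\<forall>x y. h (x + y) = h x + h y) \<and>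
     (\<forall>c x. h (c *\<^sub>C x) = c *\<^sub>C h x) \<and>
     (\<forall>x y. h (x * y) = h x * h y) \<and>
     (\<forall>x. h (cstar x) = cstar (h x)) \<and>
     h 1 = 1"

definition cadj :: "complex mat \<Rightarrow> complex mat" where
  "cadj A = mat (dim_col A) (dim_row A) (\<lambda>(i, j). cnj (A $$ (j, i)))"

definition matrix_subalgebra :: "'a::cstar_algebra_1 set \<Rightarrow> nat \<Rightarrow> bool" where
  "matrix_subalgebra F n \<longleftrightarrow> n \<ge> 1 \<and>
     (\<exists>h :: complex mat \<Rightarrow> 'a.
        bij_betw h (carrier_mat n n) F \<and>
        (\<forall>A\<in>carrier_mat n n. \<forall>B\<in>carrier_mat n n. h (A + B) = h A + h B \<and> h (A * B) = h A * h B) \<and>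
        (\<forall>c. \<forall>A\<in>carrier_mat n n. h (c \<cdot>\<^sub>m A) = c *\<^sub>C h A) \<and>
        (\<forall>A\<in>carrier_mat n n. h (cadj A) = cstar (h A)) \<and>
        h (1\<^sub>m n) = 1)"

definition full_matrix_subalgebra :: "'a::cstar_algebra_1 set \<Rightarrow> bool" where
  "full_matrix_subalgebra F \<longleftrightarrow> (\<exists>n. matrix_subalgebra F n)"

text \<open>The whole algebra is the closure of an increasing union of unital full matrix
  subalgebras F_k of size k!; by Glimm's classification this is the UHF algebra with
  (K_0, K_0^+, [1]) = (Q, Q_+, 1).\<close>
definition is_universal_UHF :: "'a::cstar_algebra_1 itself \<Rightarrow> bool" where
  "is_universal_UHF _ \<longleftrightarrow>
     (\<exists>F :: nat \<Rightarrow> 'a set. (\<forall>k. F k \<subseteq> F (Suc k)) \<and>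
        (\<forall>k. matrix_subalgebra (F k) (fact k)) \<and>
        closure (\<Union>k. F k) = UNIV)"

text \<open>Elements of C(X,A) are represented by functions real => A, continuous on X;
  only their values on X matter.\<close>

definition cnorm :: "real set \<Rightarrow> (real \<Rightarrow> 'a::real_normed_vector) \<Rightarrow> real" where
  "cnorm X f = (SUP t\<in>X. norm (f t))"

definition cunitary :: "real set \<Rightarrow> (real \<Rightarrow> 'a::cstar_algebra_1) \<Rightarrow> bool" where
  "cunitary X u \<longleftrightarrow> continuous_on X u \<and>
     (\<forall>t\<in>X. cstar (u t) * u t = 1 \<and> u t * cstar (u t) = 1)"

definition unital_mono_C :: "real set \<Rightarrow> ('a::cstar_algebra_1 \<Rightarrow> real \<Rightarrow> 'b::cstar_algebra_1) \<Rightarrow> bool" where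
  "unital_mono_C X \<phi> \<longleftrightarrow>
     (\<forall>x. continuous_on X (\<phi> x)) \<and>
     (\<forall>t\<in>X. unital_star_hom (\<lambda>x. \<phi> x t)) \<and>
     (\<forall>x y. (\<forall>t\<in>X. \<phi> x t = \<phi> y t) \<longrightarrow> x = y)"

definition conj_by :: "(real \<Rightarrow> 'a::cstar_algebra_1) \<Rightarrow> (real \<Rightarrow> 'a) \<Rightarrow> real \<Rightarrow> 'a" where
  "conj_by u f = (\<lambda>t. cstar (u t) * f t * u t)"

end

theory Submission
  imports Defs "Jordan_Normal_Form.Spectral_Radius"
begin

text \<open>
  Fix a matrix subalgebra of \<open>Q\<close>; its matrix units have images \<open>e i j t\<close> and \<open>f i j t\<close> under the
  two homomorphisms at the point \<open>t\<close>. At one point the two systems are unitarily equivalent: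
  \<open>e 0 0\<close> and \<open>f 0 0\<close> can be conjugated into a common finite-dimensional \<open>F k\<close>, where projections are
  comparable, and a partial isometry between them extends to an isometry intertwining the systems,
  which is unitary because \<open>Q\<close> is finite. Nearby systems \<open>e s\<close>, \<open>e t\<close> are intertwined by the polar part of
  \<open>\<Sum>i. e i 0 s * e 0 i t\<close>, which is continuous in \<open>t\<close>; patching along \<open>X\<close> (and
  jumping over gaps by the pointwise equivalence) gives a unitary in \<open>C(X,Q)\<close> that conjugates one
  system exactly into the other and is 1 at \<open>a\<close> if they agree there. Its value at \<open>b\<close> is corrected by a
  path in the unitary group of the commutant of the matrix algebra, which is connected.
  Density of the union of the \<open>F k\<close> and contractivity of homomorphisms give the limit statements.
\<close>

subsection \<open>Unital C*-algebras: unitaries and polar parts\<close>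

text \<open>Functional calculus enters only through the series of (1 - s)^(-1/2) on the open unit
  ball. It supplies polar parts, symmetries, square roots and, through its square, inverses; the
  constants 1/4 and 1/16 below keep the defects \<open>1 - cstar x * x\<close> well inside this
  ball. Since the series respects commutation and intertwining relations, an approximate intertwiner
  becomes a unitary that intertwines exactly. Conjugation on a matrix subalgebra is therefore exact,
  and an epsilon arises only from the density of the \<open>F k\<close>.

  Elements of the limit are only near some \<open>F k\<close> in norm. Finiteness survives because
  an isometry close to an element of \<open>F k\<close> inherits invertibility from it;
  comparability survives because a projection is unitarily equivalent to one inside some
  \<open>F k\<close>. For connectedness, the commutant of a matrix algebra is determined by its
  corner at \<open>e 0 0\<close>, so only this one projection has to be moved into an
  \<open>F k\<close>.\<close>

lemma cstar_0 [simp]: "cstar (0::'a::cstar_algebra_1) = 0"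
  using cstar_add[of "0::'a" 0] by simp

lemma scaleC_0_right [simp]: "c *\<^sub>C (0::'a::cstar_algebra_1) = 0"
  using scaleC_add_right[of c "0::'a" 0] by simp

lemma scaleC_0_left [simp]: "0 *\<^sub>C (x::'a::cstar_algebra_1) = 0"
  using scaleC_add_left[of 0 0 x] by simp

lemma cstar_scaleR: "cstar (r *\<^sub>R x) = r *\<^sub>R cstar (x::'a::cstar_algebra_1)"
  by (simp add: scaleR_scaleC cstar_scaleC)

lemma cstar_minus: "cstar (- x) = - cstar (x::'a::cstar_algebra_1)"
  using cstar_scaleR[of "-1" x] by simp

lemma cstar_diff: "cstar (x - y) = cstar x - cstar (y::'a::cstar_algebra_1)"
  using cstar_add[of x "- y"] by (simp add: cstar_minus)

lemma cstar_1 [simp]: "cstar (1::'a::cstar_algebra_1) = 1"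
  by (metis cstar_cstar cstar_mult mult.right_neutral mult.left_neutral)

lemma cstar_sum: "cstar (\<Sum>i\<in>I. f i) = (\<Sum>i\<in>I. cstar (f i :: 'a::cstar_algebra_1))"
  by (induction I rule: infinite_finite_induct) (auto simp: cstar_add)

lemma cstar_power: "cstar (x ^ n) = cstar (x::'a::cstar_algebra_1) ^ n"
  by (induction n) (auto simp: cstar_mult power_commutes)

lemma norm_cstar [simp]: "norm (cstar x) = norm (x::'a::cstar_algebra_1)"
proof -
  have le: "norm y \<le> norm (cstar y)" for y :: 'a
  proof (cases "y = 0")
    case False
    have "(norm y)\<^sup>2 \<le> norm (cstar y) * norm y"
      using norm_mult_ineq[of "cstar y" y] cstar_identity[of y] by simp
    then show ?thesis using False by (simp add: power2_eq_square)
  qed auto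
  show ?thesis using le[of x] le[of "cstar x"] by (simp add: cstar_cstar)
qed

lemma bounded_linear_cstar: "bounded_linear (cstar :: 'a::cstar_algebra_1 \<Rightarrow> 'a)"
  by (rule bounded_linear_intro[where K = 1]) (auto simp: cstar_add cstar_scaleR)

lemmas continuous_on_cstar [continuous_intros] =
  bounded_linear.continuous_on[OF bounded_linear_cstar]

lemma scaleC_diff_left: "(c - d) *\<^sub>C x = c *\<^sub>C x - d *\<^sub>C (x::'a::cstar_algebra_1)"
  using scaleC_add_left[of "c - d" d x] by simp

lemma scaleC_diff_right: "c *\<^sub>C (x - y) = c *\<^sub>C x - c *\<^sub>C (y::'a::cstar_algebra_1)"
  using scaleC_add_right[of c "x - y" y] by simp

lemma bounded_linear_scaleC: "bounded_linear (\<lambda>c. c *\<^sub>C (x::'a::cstar_algebra_1))"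
  by (rule bounded_linear_intro[where K = "norm x"])
    (auto simp: scaleC_add_left norm_scaleC scaleR_scaleC scaleC_scaleC scaleR_conv_of_real)

lemma eq_zero_if_cstar_mult_zero: "cstar x * x = 0 \<Longrightarrow> x = (0::'a::cstar_algebra_1)"
  using cstar_identity[of x] by simp

definition unitary :: "'a::cstar_algebra_1 \<Rightarrow> bool" where
  "unitary u \<longleftrightarrow> cstar u * u = 1 \<and> u * cstar u = 1"

lemma unitaryD: "unitary u \<Longrightarrow> cstar u * u = 1" "unitary u \<Longrightarrow> u * cstar u = 1"
  by (auto simp: unitary_def)

lemma unitary_cancel:
  assumes "unitary u"
  shows "cstar u * (u * x) = x" "u * (cstar u * x) = x"
  by (simp_all add: mult.assoc[symmetric] unitaryD[OF assms])

lemma unitary_1 [simp]: "unitary 1"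
  by (simp add: unitary_def)

lemma unitary_cstar: "unitary u \<Longrightarrow> unitary (cstar u)"
  by (simp add: unitary_def cstar_cstar)

lemma unitary_mult: "unitary u \<Longrightarrow> unitary v \<Longrightarrow> unitary (u * v)"
  by (simp add: unitary_def cstar_mult) (metis mult.assoc mult.right_neutral)

lemma norm_isometry: "cstar u * u = 1 \<Longrightarrow> norm u = (1::real)"
  using cstar_identity[of u] by (simp add: power2_eq_1_iff) (metis norm_ge_zero not_one_le_zero neg_0_le_iff_le le_minus_one_simps(3))

lemma unitary_norm: "unitary u \<Longrightarrow> norm u = 1"
  by (simp add: norm_isometry unitary_def)

section \<open>The binomial series of (1 - s)^(-1/2)\<close>

definition inv_sqrt_coeff :: "nat \<Rightarrow> real" where
  "inv_sqrt_coeff n = (- 1) ^ n * ((- 1 / 2) gchoose n)"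

text \<open>The sign in \<open>inv_sqrt_coeff\<close> is that of substituting -s into the binomial
  series. It makes all coefficients nonnegative: they are binomial(2n, n) / 4^n.\<close>

definition inv_sqrt_one_minus :: "'a::{real_normed_algebra_1,banach} \<Rightarrow> 'a" where
  "inv_sqrt_one_minus s = (\<Sum>n. inv_sqrt_coeff n *\<^sub>R s ^ n)"

lemma inv_sqrt_coeff_0 [simp]: "inv_sqrt_coeff 0 = 1"
  by (simp add: inv_sqrt_coeff_def)

lemma inv_sqrt_one_minus_0 [simp]: "inv_sqrt_one_minus 0 = 1"
proof -
  have "inv_sqrt_coeff n *\<^sub>R (0::'a) ^ n = 0" if "n \<notin> {0}" for n
    using that by (cases n) auto
  then show ?thesis
    unfolding inv_sqrt_one_minus_def by (subst suminf_finite[of "{0}"]) auto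
qed

lemma inv_sqrt_coeff_Suc:
  "inv_sqrt_coeff (Suc n) = inv_sqrt_coeff n * ((2 * real n + 1) / (2 * real n + 2))"
proof -
  have "real (Suc n) * ((- 1 / 2) gchoose Suc n) = ((- 1 / 2) - real n) * ((- 1 / 2) gchoose n)"
    using gbinomial_mult_1[of "- 1 / 2 :: real" n] by (simp add: algebra_simps)
  then have "((- 1 / 2 :: real) gchoose Suc n) = ((- 1 / 2) - real n) * ((- 1 / 2) gchoose n) / real (Suc n)"
    by (simp add: field_simps)
  then have "inv_sqrt_coeff (Suc n) = (- 1) ^ n * ((- 1 / 2) gchoose n) * ((1 / 2 + real n) / real (Suc n))"
    unfolding inv_sqrt_coeff_def by (simp only: power_Suc) (simp add: field_simps)
  moreover have "(1 / 2 + real n) / real (Suc n) = (2 * real n + 1) / (2 * real n + 2)"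
    by (simp add: field_simps)
  ultimately show ?thesis
    by (simp only: inv_sqrt_coeff_def)
qed

lemma inv_sqrt_coeff_bounds: "0 \<le> inv_sqrt_coeff n \<and> inv_sqrt_coeff n \<le> 1"
proof (induction n)
  case (Suc n)
  have "(2 * real n + 1) / (2 * real n + 2) \<le> 1" by simp
  then show ?case
    using Suc mult_mono[of "inv_sqrt_coeff n" 1 "(2 * real n + 1) / (2 * real n + 2)" 1]
    by (auto simp: inv_sqrt_coeff_Suc)
qed auto

text \<open>Vandermonde's identity with -1/2 + -1/2 = -1: the squared series is that of (1 -
  s)^(-1), whose coefficients are all 1.\<close>

lemma inv_sqrt_coeff_convolution: "(\<Sum>i\<le>n. inv_sqrt_coeff i * inv_sqrt_coeff (n - i)) = 1"
proof -
  have "(\<Sum>i\<le>n. inv_sqrt_coeff i * inv_sqrt_coeff (n - i))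
      = (\<Sum>i\<le>n. (- 1) ^ n * (((- 1 / 2) gchoose i) * ((- 1 / 2) gchoose (n - i))))"
    by (intro sum.cong refl) (auto simp: inv_sqrt_coeff_def power_add[symmetric] mult_ac)
  also have "\<dots> = (- 1) ^ n * ((- 1 / 2 + - 1 / 2 :: real) gchoose n)"
    by (simp only: sum_distrib_left[symmetric] gbinomial_Vandermonde[symmetric] atLeast0AtMost)
  also have "\<dots> = 1"
    using gbinomial_minus[of "1::real" n] binomial_gbinomial[of n n, where ?'a = real]
    by (simp add: power_add[symmetric])
  finally show ?thesis .
qed

lemma inv_sqrt_summable_norm:
  fixes s :: "'a::{real_normed_algebra_1,banach}"
  assumes s: "norm s < 1"
  shows "summable (\<lambda>n. norm (inv_sqrt_coeff n *\<^sub>R s ^ n))"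
proof (rule summable_comparison_test')
  show "summable (\<lambda>n. norm s ^ n)" using s by simp
  show "norm (norm (inv_sqrt_coeff n *\<^sub>R s ^ n)) \<le> norm s ^ n" if "n \<ge> 0" for n
    using inv_sqrt_coeff_bounds[of n] mult_mono[of "inv_sqrt_coeff n" 1 "norm (s ^ n)" "norm s ^ n"]
    by (simp add: norm_power_ineq)
qed

lemma inv_sqrt_sums:
  fixes s :: "'a::{real_normed_algebra_1,banach}"
  assumes s: "norm s < 1"
  shows "(\<lambda>n. inv_sqrt_coeff n *\<^sub>R s ^ n) sums inv_sqrt_one_minus s"
  unfolding inv_sqrt_one_minus_def
  by (rule summable_sums[OF summable_norm_cancel[OF inv_sqrt_summable_norm[OF s]]])

lemma inv_sqrt_square_sums:
  fixes s :: "'a::{real_normed_algebra_1,banach}"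
  assumes s: "norm s < 1"
  shows "(\<lambda>n. s ^ n) sums (inv_sqrt_one_minus s * inv_sqrt_one_minus s)"
proof -
  have "(\<Sum>i\<le>n. (inv_sqrt_coeff i *\<^sub>R s ^ i) * (inv_sqrt_coeff (n - i) *\<^sub>R s ^ (n - i))) = s ^ n" for n
  proof -
    have "(\<Sum>i\<le>n. (inv_sqrt_coeff i *\<^sub>R s ^ i) * (inv_sqrt_coeff (n - i) *\<^sub>R s ^ (n - i)))
       = (\<Sum>i\<le>n. (inv_sqrt_coeff i * inv_sqrt_coeff (n - i)) *\<^sub>R s ^ n)"
      by (intro sum.cong refl) (auto simp: power_add[symmetric])
    then show ?thesis
      by (simp add: scaleR_sum_left[symmetric] inv_sqrt_coeff_convolution)
  qed
  then show ?thesis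
    using Cauchy_product_sums[OF inv_sqrt_summable_norm[OF s] inv_sqrt_summable_norm[OF s]]
    by (simp add: inv_sqrt_one_minus_def)
qed

text \<open>The relation passes to powers and then termwise to the series. Two different arguments
  occur because polar parts need the swap between \<open>1 - cstar x * x\<close> and
  \<open>1 - x * cstar x\<close>.\<close>

lemma inv_sqrt_intertwine:
  fixes s t :: "'a::{real_normed_algebra_1,banach}"
  assumes s: "norm s < 1" and t: "norm t < 1" and "x * s = t * x"
  shows "x * inv_sqrt_one_minus s = inv_sqrt_one_minus t * x"
proof -
  have p: "x * s ^ n = t ^ n * x" for n
  proof (induction n)
    case (Suc n)
    have "x * s ^ Suc n = t * (x * s ^ n)"
      using assms(3) by (simp add: mult.assoc[symmetric])
    then show ?case by (simp add: Suc mult.assoc)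
  qed auto
  have "(\<lambda>n. x * (inv_sqrt_coeff n *\<^sub>R s ^ n)) sums (x * inv_sqrt_one_minus s)"
    by (intro sums_mult inv_sqrt_sums s)
  moreover have "(\<lambda>n. (inv_sqrt_coeff n *\<^sub>R t ^ n) * x) sums (inv_sqrt_one_minus t * x)"
    by (intro sums_mult2 inv_sqrt_sums t)
  ultimately show ?thesis
    by (simp add: p sums_unique2)
qed

lemma inv_sqrt_commute:
  fixes s :: "'a::{real_normed_algebra_1,banach}"
  shows "norm s < 1 \<Longrightarrow> x * s = s * x \<Longrightarrow> x * inv_sqrt_one_minus s = inv_sqrt_one_minus s * x"
  by (rule inv_sqrt_intertwine)

text \<open>The square of the series is the geometric series, which inverts \<open>1 - s\<close>;
  the other arrangements of the factors follow by commutation.\<close>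

lemma inv_sqrt_square_inverse:
  fixes s :: "'a::{real_normed_algebra_1,banach}"
  assumes s: "norm s < 1"
  shows "inv_sqrt_one_minus s * inv_sqrt_one_minus s * (1 - s) = 1"
    and "(1 - s) * (inv_sqrt_one_minus s * inv_sqrt_one_minus s) = 1"
    and "inv_sqrt_one_minus s * (1 - s) * inv_sqrt_one_minus s = 1"
proof -
  let ?R = "inv_sqrt_one_minus s"
  have lim: "(\<lambda>n. \<Sum>i<n. s ^ i) \<longlonglongrightarrow> ?R * ?R"
    using inv_sqrt_square_sums[OF s] by (simp add: sums_def)
  have "(1 - s) * (\<Sum>i<n. s ^ i) = 1 - s ^ n" for n
  proof (induction n)
    case (Suc n)
    have "(1 - s) * (\<Sum>i<Suc n. s ^ i) = (1 - s ^ n) + (1 - s) * s ^ n"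
      by (simp add: distrib_left Suc)
    then show ?case by (simp add: left_diff_distrib)
  qed auto
  moreover have "(\<lambda>n. s ^ n) \<longlonglongrightarrow> 0"
    by (rule LIMSEQ_power_zero[OF s])
  ultimately have "(\<lambda>n. (1 - s) * (\<Sum>i<n. s ^ i)) \<longlonglongrightarrow> 1 - 0"
    using tendsto_diff[OF tendsto_const, of "\<lambda>n. s ^ n" 0 sequentially 1] by simp
  with tendsto_mult_left[OF lim, of "1 - s"] show 1: "(1 - s) * (?R * ?R) = 1"
    using LIMSEQ_unique by fastforce
  have c: "(1 - s) * ?R = ?R * (1 - s)"
    by (rule inv_sqrt_commute[OF s]) (simp add: algebra_simps)
  show "?R * (1 - s) * ?R = 1"
    using 1 c by (metis mult.assoc)
  show "?R * ?R * (1 - s) = 1"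
    using 1 c by (metis mult.assoc)
qed

text \<open>The coefficients are at most 1, so the tail is dominated by the sum of 4^(-n) over n
  \<ge> 1, which is 1/3.\<close>

lemma inv_sqrt_near_1:
  fixes s :: "'a::{real_normed_algebra_1,banach}"
  assumes s: "norm s \<le> 1 / 4"
  shows "norm (inv_sqrt_one_minus s - 1) \<le> 1 / 3"
proof -
  have s1: "norm s < 1" using s by simp
  let ?f = "\<lambda>n. inv_sqrt_coeff n *\<^sub>R s ^ n"
  have "inv_sqrt_one_minus s - 1 = (\<Sum>n. ?f (Suc n))"
    using suminf_split_head[of ?f] inv_sqrt_sums[OF s1] by (simp add: sums_iff inv_sqrt_one_minus_def)
  also have "norm \<dots> \<le> (\<Sum>n. (1 / 4) ^ Suc n)"
  proof (rule norm_suminf_le)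
    show "norm (?f (Suc n)) \<le> (1 / 4) ^ Suc n" for n
    proof -
      have "norm (s ^ Suc n) \<le> (1 / 4) ^ Suc n"
        using norm_power_ineq[of s "Suc n"] power_mono[OF s, of "Suc n"] by simp
      then show ?thesis
        using inv_sqrt_coeff_bounds[of "Suc n"] mult_mono[of "inv_sqrt_coeff (Suc n)" 1 "norm (s ^ Suc n)" "(1 / 4) ^ Suc n"]
        by (simp del: power_Suc)
    qed
    show "summable (\<lambda>n. (1 / 4 :: real) ^ Suc n)"
      by (subst summable_Suc_iff) (simp add: summable_geometric)
  qed
  also have "\<dots> = 1 / 3"
    using suminf_mult[of "\<lambda>n. (1 / 4 :: real) ^ n" "1 / 4"] suminf_geometric[of "1 / 4 :: real"]
    by (simp add: summable_geometric)
  finally show ?thesis .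
qed

lemma cstar_inv_sqrt:
  fixes s :: "'a::cstar_algebra_1"
  assumes s: "norm s < 1"
  shows "cstar (inv_sqrt_one_minus s) = inv_sqrt_one_minus (cstar s)"
proof -
  have "(\<lambda>n. cstar (inv_sqrt_coeff n *\<^sub>R s ^ n)) sums cstar (inv_sqrt_one_minus s)"
    by (rule bounded_linear.sums[OF bounded_linear_cstar inv_sqrt_sums[OF s]])
  moreover have "(\<lambda>n. inv_sqrt_coeff n *\<^sub>R cstar s ^ n) sums inv_sqrt_one_minus (cstar s)"
    by (rule inv_sqrt_sums) (use s in simp)
  ultimately show ?thesis
    by (simp add: cstar_scaleR cstar_power sums_unique2)
qed

lemma inv_sqrt_in_closed_subalgebra:
  fixes s :: "'a::{real_normed_algebra_1,banach}"
  assumes s: "norm s < 1" "s \<in> S" and S: "closed S" "real_vector.subspace S" "1 \<in> S"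
    and mult: "\<And>x y. x \<in> S \<Longrightarrow> y \<in> S \<Longrightarrow> x * y \<in> S"
  shows "inv_sqrt_one_minus s \<in> S"
proof -
  have "s ^ n \<in> S" for n
    by (induction n) (auto simp: S s mult)
  then have "(\<Sum>i<n. inv_sqrt_coeff i *\<^sub>R s ^ i) \<in> S" for n
    by (intro real_vector.subspace_sum real_vector.subspace_scale S)
  then show ?thesis
    using inv_sqrt_sums[OF s(1)] S(1) unfolding sums_def by (metis closed_sequentially)
qed

lemma continuous_on_inv_sqrt:
  fixes f :: "'b::topological_space \<Rightarrow> 'a::{real_normed_algebra_1,banach}"
  assumes f: "continuous_on X f" and r: "r < 1" "\<And>t. t \<in> X \<Longrightarrow> norm (f t) \<le> r"
  shows "continuous_on X (\<lambda>t. inv_sqrt_one_minus (f t))"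
proof (cases "X = {}")
  case False
  then have r0: "0 \<le> r" using r(2) norm_ge_zero order_trans by blast
  have "uniform_limit X (\<lambda>n t. \<Sum>i<n. inv_sqrt_coeff i *\<^sub>R f t ^ i) (\<lambda>t. \<Sum>i. inv_sqrt_coeff i *\<^sub>R f t ^ i) sequentially"
  proof (rule Weierstrass_m_test)
    show "summable (\<lambda>n. r ^ n)" using r r0 by simp
    show "norm (inv_sqrt_coeff n *\<^sub>R f t ^ n) \<le> r ^ n" if "t \<in> X" for n t
    proof -
      have "norm (f t ^ n) \<le> r ^ n"
        using norm_power_ineq[of "f t" n] power_mono[OF r(2)[OF that] norm_ge_zero, of n] by simp
      then show ?thesis
        using inv_sqrt_coeff_bounds[of n] mult_mono[of "inv_sqrt_coeff n" 1 "norm (f t ^ n)" "r ^ n"] by simp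
    qed
  qed
  then show ?thesis
    unfolding inv_sqrt_one_minus_def
    by (rule uniform_limit_theorem[rotated]) (auto intro!: continuous_intros f eventuallyI)
qed auto

section \<open>Polar parts of elements close to a unitary\<close>

definition polar_part :: "'a::cstar_algebra_1 \<Rightarrow> 'a" where
  "polar_part x = x * inv_sqrt_one_minus (1 - cstar x * x)"

lemma polar_part_1 [simp]: "polar_part 1 = 1"
  by (simp add: polar_part_def inv_sqrt_one_minus_0)

text \<open>The series at \<open>1 - cstar x * x\<close> is |x|^(-1), so \<open>polar_part x\<close>
  is x |x|^(-1). Moving x through the series turns this into |x^*|^(-1) x, and the same computation
  then gives the second unitarity relation.\<close>

lemma unitary_polar_part:
  assumes "norm (1 - cstar x * x) < 1" "norm (1 - x * cstar x) < 1"
  shows "unitary (polar_part x)"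
proof -
  let ?R = "inv_sqrt_one_minus (1 - cstar x * x)" and ?S = "inv_sqrt_one_minus (1 - x * cstar x)"
  have sa: "cstar ?R = ?R" "cstar ?S = ?S"
    by (simp_all add: cstar_inv_sqrt assms cstar_diff cstar_mult cstar_cstar)
  have xR: "x * ?R = ?S * x"
    by (rule inv_sqrt_intertwine) (auto simp: assms algebra_simps)
  have "cstar (x * ?R) * (x * ?R) = ?R * (cstar x * x) * ?R"
    by (simp add: cstar_mult sa mult.assoc)
  also have "\<dots> = 1" using inv_sqrt_square_inverse(3)[OF assms(1)] by simp
  finally have 1: "cstar (x * ?R) * (x * ?R) = 1" .
  have "(x * ?R) * cstar (x * ?R) = ?S * (x * cstar x) * ?S"
    by (simp add: xR) (simp add: cstar_mult sa mult.assoc)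
  also have "\<dots> = 1" using inv_sqrt_square_inverse(3)[OF assms(2)] by simp
  finally show ?thesis using 1 by (simp add: unitary_def polar_part_def)
qed

text \<open>The two relations together make b commute with \<open>cstar x * x\<close>, hence with
  the series; the first relation alone then handles the remaining factor x.\<close>

lemma polar_part_intertwine:
  assumes "norm (1 - cstar x * x) < 1" and "a * x = x * b" "b * cstar x = cstar x * a"
  shows "a * polar_part x = polar_part x * b"
proof -
  have "b * (1 - cstar x * x) = (1 - cstar x * x) * b"
    using assms(2,3) by (simp add: algebra_simps) (metis mult.assoc)
  then have "b * inv_sqrt_one_minus (1 - cstar x * x) = inv_sqrt_one_minus (1 - cstar x * x) * b"
    by (rule inv_sqrt_commute[OF assms(1)])
  then show ?thesis
    using assms(2) by (simp add: polar_part_def mult.assoc) (metis mult.assoc)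
qed

text \<open>The factor is 5/4 + 1, from ||x|| \<le> 1 + 1/4 and ||y|| = 1. For d = 1/4 the defect is
  at most 9/16 < 1, enough for the series; for d = 1/16 it is at most 9/64, enough for
  \<open>inv_sqrt_near_1\<close>.\<close>

lemma almost_unitary_bounds:
  assumes y: "unitary y" and xy: "norm (x - y) \<le> d" and d: "d \<le> 1 / 4"
  shows "norm (1 - cstar x * x) \<le> (9 / 4) * d" "norm (1 - x * cstar x) \<le> (9 / 4) * d"
proof -
  have nx: "norm x \<le> 5 / 4"
    using norm_triangle_ineq[of y "x - y"] xy d unitary_norm[OF y] by simp
  have d0: "0 \<le> d" using xy norm_ge_zero order_trans by blast
  have cxy: "norm (cstar x - cstar y) \<le> d" using xy by (metis cstar_diff norm_cstar)
  have "1 - cstar x * x = - ((cstar x - cstar y) * x + cstar y * (x - y))"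
    using y by (simp add: unitary_def algebra_simps)
  also have "norm \<dots> \<le> norm (cstar x - cstar y) * norm x + norm (cstar y) * norm (x - y)"
    unfolding norm_minus_cancel by (rule order_trans[OF norm_triangle_ineq]) (intro add_mono norm_mult_ineq)
  also have "\<dots> \<le> d * (5 / 4) + 1 * d"
    using cxy xy nx d0 unitary_norm[OF y] by (intro add_mono mult_mono) auto
  finally show "norm (1 - cstar x * x) \<le> (9 / 4) * d" by simp
  have "1 - x * cstar x = - (x * (cstar x - cstar y) + (x - y) * cstar y)"
    using y by (simp add: unitary_def algebra_simps)
  also have "norm \<dots> \<le> norm x * norm (cstar x - cstar y) + norm (x - y) * norm (cstar y)"
    unfolding norm_minus_cancel by (rule order_trans[OF norm_triangle_ineq]) (intro add_mono norm_mult_ineq)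
  also have "\<dots> \<le> (5 / 4) * d + d * 1"
    using cxy xy nx d0 unitary_norm[OF y] by (intro add_mono mult_mono) auto
  finally show "norm (1 - x * cstar x) \<le> (9 / 4) * d" by simp
qed

lemma polar_part_near_unitary:
  assumes y: "unitary y" and xy: "norm (x - y) \<le> 1 / 4"
  shows "unitary (polar_part x)"
  using almost_unitary_bounds[OF y xy] by (intro unitary_polar_part) auto

lemma polar_part_near_1:
  assumes "norm (x - 1) \<le> 1 / 4"
  shows "unitary (polar_part x)"
    and "a * x = x * b \<Longrightarrow> b * cstar x = cstar x * a \<Longrightarrow> a * polar_part x = polar_part x * b"
  using almost_unitary_bounds[OF unitary_1 assms]
  by (auto intro!: unitary_polar_part polar_part_intertwine)

lemma continuous_on_polar_part:
  fixes x :: "'b::topological_space \<Rightarrow> 'a::cstar_algebra_1"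
  assumes "continuous_on X x" "\<And>t. t \<in> X \<Longrightarrow> norm (x t - 1) \<le> 1 / 4"
  shows "continuous_on X (\<lambda>t. polar_part (x t))"
  unfolding polar_part_def
proof (intro continuous_intros assms(1) continuous_on_inv_sqrt)
  show "(9 / 16 :: real) < 1" by simp
  show "norm (1 - cstar (x t) * x t) \<le> 9 / 16" if "t \<in> X" for t
    using almost_unitary_bounds(1)[OF unitary_1 assms(2)[OF that]] by simp
qed

section \<open>Inverses and their continuity\<close>

lemma neumann_inverse:
  fixes x :: "'a::{real_normed_algebra_1,banach}"
  assumes "norm (1 - x) < 1"
  obtains y where "y * x = 1" "x * y = 1"
  using inv_sqrt_square_inverse[OF assms] that by simp

lemma continuous_on_inverse_elements:
  fixes x y :: "'b::metric_space \<Rightarrow> 'a::real_normed_algebra_1"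
  assumes x: "continuous_on S x" and inv: "\<And>t. t \<in> S \<Longrightarrow> y t * x t = 1 \<and> x t * y t = 1"
  shows "continuous_on S y"
  unfolding continuous_on_iff
proof (intro ballI allI impI)
  fix p :: 'b and \<epsilon> :: real assume p: "p \<in> S" and \<epsilon>: "\<epsilon> > 0"
  define M where "M = norm (y p) + 1"
  have M: "M > 0" "norm (y p) \<le> M" by (auto simp: M_def add_nonneg_pos)
  \<comment> \<open>The first bound lets half of ||y t|| be absorbed, so that ||y t|| \<le> 2 M;
    with that, the second makes the difference at most \<epsilon> / 2.\<close>
  define \<eta> where "\<eta> = min (1 / (2 * M)) (\<epsilon> / (4 * M * M))"
  have \<eta>: "\<eta> > 0" using M \<epsilon> by (auto simp: \<eta>_def)
  obtain d where d: "d > 0" "\<And>t. t \<in> S \<Longrightarrow> dist t p < d \<Longrightarrow> dist (x t) (x p) < \<eta>"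
    using x p \<eta> unfolding continuous_on_iff by blast
  show "\<exists>d>0. \<forall>t\<in>S. dist t p < d \<longrightarrow> dist (y t) (y p) < \<epsilon>"
  proof (intro exI[of _ d] conjI ballI impI d(1))
    fix t assume t: "t \<in> S" "dist t p < d"
    have \<delta>: "norm (x p - x t) < \<eta>" using d(2)[OF t] by (simp add: dist_norm norm_minus_commute)
    have eq: "y t - y p = y t * (x p - x t) * y p"
    proof -
      have "y t * (x p - x t) * y p = y t * (x p * y p) - (y t * x t) * y p"
        by (simp only: right_diff_distrib left_diff_distrib mult.assoc)
      then show ?thesis using inv[OF p] inv[OF t(1)] by simp
    qed
    have le: "norm (y t - y p) \<le> norm (y t) * norm (x p - x t) * M"
      unfolding eq by (rule order_trans[OF norm_mult_ineq]) (intro mult_mono norm_mult_ineq M norm_ge_zero mult_nonneg_nonneg)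
    also have "\<dots> \<le> norm (y t) * \<eta> * M"
      using \<delta> M \<eta> by (intro mult_mono mult_nonneg_nonneg) auto
    finally have le': "norm (y t - y p) \<le> norm (y t) * \<eta> * M" .
    also have "\<dots> \<le> norm (y t) * (1 / (2 * M)) * M"
      using M \<eta> \<epsilon> by (intro mult_mono) (auto simp: \<eta>_def)
    finally have "norm (y t - y p) \<le> norm (y t) / 2" using M by simp
    then have "norm (y t) \<le> 2 * M"
      using norm_triangle_ineq2[of "y t" "y p"] M by linarith
    then have "norm (y t) * \<eta> * M \<le> (2 * M) * (\<epsilon> / (4 * M * M)) * M"
      using M \<eta> \<epsilon> by (intro mult_mono) (auto simp: \<eta>_def)
    also have "\<dots> = \<epsilon> / 2" using M by (simp add: field_simps)
    finally show "dist (y t) (y p) < \<epsilon>" using le' \<epsilon> by (simp add: dist_norm)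
  qed
qed

subsection \<open>Matrix units and matrix subalgebras\<close>

definition matrix_units :: "nat \<Rightarrow> (nat \<Rightarrow> nat \<Rightarrow> 'a::cstar_algebra_1) \<Rightarrow> bool" where
  "matrix_units n e \<longleftrightarrow>
     (\<forall>i<n. \<forall>j<n. \<forall>k<n. \<forall>l<n. e i j * e k l = (if j = k then e i l else 0)) \<and>
     (\<forall>i<n. \<forall>j<n. cstar (e i j) = e j i) \<and> (\<Sum>i<n. e i i) = 1"

lemma matrix_units_mult:
  "matrix_units n e \<Longrightarrow> i < n \<Longrightarrow> j < n \<Longrightarrow> k < n \<Longrightarrow> l < n \<Longrightarrow>
    e i j * e k l = (if j = k then e i l else 0)"
  by (simp add: matrix_units_def)

lemma matrix_units_mult_assoc:
  "matrix_units n e \<Longrightarrow> i < n \<Longrightarrow> j < n \<Longrightarrow> k < n \<Longrightarrow> l < n \<Longrightarrow>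
    e i j * (e k l * x) = (if j = k then e i l * x else 0)"
  by (simp add: matrix_units_def mult.assoc[symmetric])

lemma matrix_units_cstar:
  "matrix_units n e \<Longrightarrow> i < n \<Longrightarrow> j < n \<Longrightarrow> cstar (e i j) = e j i"
  by (simp add: matrix_units_def)

lemma matrix_units_sum: "matrix_units n e \<Longrightarrow> (\<Sum>i<n. e i i) = 1"
  by (simp add: matrix_units_def)

lemma matrix_units_pos: "matrix_units n e \<Longrightarrow> 0 < n"
  by (cases n) (auto simp: matrix_units_def)

lemma matrix_units_nonzero:
  assumes e: "matrix_units n e" and "i < n" "j < n"
  shows "e i j \<noteq> 0"
proof
  assume 0: "e i j = 0"
  have "e k k = 0" if "k < n" for k
  proof -
    have "e k k = e k i * (e i j * e j k)"
      using that assms by (simp add: matrix_units_mult[OF e])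
    then show ?thesis by (simp add: 0)
  qed
  then show False using matrix_units_sum[OF e] by simp
qed

lemma matrix_units_image:
  assumes e: "matrix_units n e" and h: "unital_star_hom h"
  shows "matrix_units n (\<lambda>i j. h (e i j))"
proof -
  have add: "h (x + y) = h x + h y" and mult: "h (x * y) = h x * h y"
    and star: "h (cstar x) = cstar (h x)" and one: "h 1 = 1" for x y
    using h by (auto simp: unital_star_hom_def)
  have zero: "h 0 = 0" using add[of 0 0] by simp
  have sum: "h (\<Sum>i\<in>I. f i) = (\<Sum>i\<in>I. h (f i))" for f :: "nat \<Rightarrow> 'a" and I
    by (induction I rule: infinite_finite_induct) (auto simp: add zero)
  show ?thesis
    using e by (simp add: matrix_units_def mult[symmetric] star[symmetric] sum[symmetric] zero one)
qed

definition projection :: "'a::cstar_algebra_1 \<Rightarrow> bool" where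
  "projection p \<longleftrightarrow> p * p = p \<and> cstar p = p"

lemma projection_matrix_unit:
  "matrix_units n e \<Longrightarrow> i < n \<Longrightarrow> projection (e i i)"
  by (simp add: projection_def matrix_units_mult matrix_units_cstar)

section \<open>Closed star subalgebras\<close>

definition star_subalgebra :: "'a::cstar_algebra_1 set \<Rightarrow> bool" where
  "star_subalgebra S \<longleftrightarrow> 1 \<in> S \<and> (\<forall>x\<in>S. \<forall>y\<in>S. x + y \<in> S \<and> x * y \<in> S) \<and>
     (\<forall>x\<in>S. cstar x \<in> S \<and> (\<forall>c. c *\<^sub>C x \<in> S))"

lemma star_subalgebraD:
  assumes "star_subalgebra S"
  shows "1 \<in> S" "x \<in> S \<Longrightarrow> y \<in> S \<Longrightarrow> x + y \<in> S" "x \<in> S \<Longrightarrow> y \<in> S \<Longrightarrow> x * y \<in> S"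
    "x \<in> S \<Longrightarrow> cstar x \<in> S" "x \<in> S \<Longrightarrow> c *\<^sub>C x \<in> S" "x \<in> S \<Longrightarrow> r *\<^sub>R x \<in> S"
    "x \<in> S \<Longrightarrow> y \<in> S \<Longrightarrow> x - y \<in> S" "0 \<in> S"
proof -
  show *: "1 \<in> S" "x \<in> S \<Longrightarrow> y \<in> S \<Longrightarrow> x + y \<in> S" "x \<in> S \<Longrightarrow> y \<in> S \<Longrightarrow> x * y \<in> S"
    "x \<in> S \<Longrightarrow> cstar x \<in> S" "x \<in> S \<Longrightarrow> c *\<^sub>C x \<in> S" for x y c
    using assms by (auto simp: star_subalgebra_def)
  show "x \<in> S \<Longrightarrow> r *\<^sub>R x \<in> S" for x r by (simp add: scaleR_scaleC *)
  from this[of _ "-1"] show "x \<in> S \<Longrightarrow> y \<in> S \<Longrightarrow> x - y \<in> S" for x y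
    using *(2)[of x "- y"] by simp
  show "0 \<in> S" using *(5)[OF *(1), of 0] by simp
qed

lemma star_subalgebra_subspace: "star_subalgebra S \<Longrightarrow> real_vector.subspace S"
  by (simp add: real_vector.subspace_def star_subalgebraD)

lemma inv_sqrt_in_star_subalgebra:
  "star_subalgebra S \<Longrightarrow> closed S \<Longrightarrow> norm s < 1 \<Longrightarrow> s \<in> S \<Longrightarrow> inv_sqrt_one_minus s \<in> S"
  by (intro inv_sqrt_in_closed_subalgebra star_subalgebra_subspace) (auto simp: star_subalgebraD)

lemma polar_part_in_star_subalgebra:
  assumes "star_subalgebra S" "closed S" "norm (1 - cstar x * x) < 1" "x \<in> S"
  shows "polar_part x \<in> S"
proof -
  have "1 - cstar x * x \<in> S"
    by (simp add: star_subalgebraD[OF assms(1)] assms(4))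
  then show ?thesis
    unfolding polar_part_def
    by (intro star_subalgebraD(3)[OF assms(1)] inv_sqrt_in_star_subalgebra assms)
qed

section \<open>Matrix subalgebras in coordinates\<close>

locale matrix_algebra =
  fixes n :: nat and h :: "complex mat \<Rightarrow> 'a::cstar_algebra_1" and F :: "'a set"
  assumes n: "n \<ge> 1" and bij: "bij_betw h (carrier_mat n n) F"
    and h_add: "A \<in> carrier_mat n n \<Longrightarrow> B \<in> carrier_mat n n \<Longrightarrow> h (A + B) = h A + h B"
    and h_mult: "A \<in> carrier_mat n n \<Longrightarrow> B \<in> carrier_mat n n \<Longrightarrow> h (A * B) = h A * h B"
    and h_smult: "A \<in> carrier_mat n n \<Longrightarrow> h (c \<cdot>\<^sub>m A) = c *\<^sub>C h A"
    and h_cadj: "A \<in> carrier_mat n n \<Longrightarrow> h (cadj A) = cstar (h A)"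
    and h_one: "h (1\<^sub>m n) = 1"
begin

definition unit :: "nat \<Rightarrow> nat \<Rightarrow> complex mat" where
  "unit i j = mat n n (\<lambda>(k, l). if k = i \<and> l = j then 1 else 0)"

lemma unit_carrier [simp]: "unit i j \<in> carrier_mat n n"
  by (simp add: unit_def)

lemma mem_iff: "x \<in> F \<longleftrightarrow> (\<exists>A\<in>carrier_mat n n. x = h A)"
  using bij by (auto simp: bij_betw_def)

lemma h_mem: "A \<in> carrier_mat n n \<Longrightarrow> h A \<in> F"
  using mem_iff by blast

lemma h_inj: "A \<in> carrier_mat n n \<Longrightarrow> B \<in> carrier_mat n n \<Longrightarrow> h A = h B \<longleftrightarrow> A = B"
  using bij by (auto simp: bij_betw_def inj_on_def)

lemma h_zero: "h (0\<^sub>m n n) = 0"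
  using h_add[of "0\<^sub>m n n" "0\<^sub>m n n"] by simp

lemma cadj_carrier: "A \<in> carrier_mat n n \<Longrightarrow> cadj A \<in> carrier_mat n n"
  by (simp add: cadj_def)

lemma star_subalgebra: "star_subalgebra F"
  unfolding star_subalgebra_def
proof (intro conjI ballI allI)
  show "1 \<in> F" using h_mem[of "1\<^sub>m n"] by (simp add: h_one)
next
  fix x y assume "x \<in> F" "y \<in> F"
  then obtain A B where AB: "A \<in> carrier_mat n n" "B \<in> carrier_mat n n" "x = h A" "y = h B"
    by (auto simp: mem_iff)
  show "x + y \<in> F" using AB h_mem[of "A + B"] by (simp add: h_add)
  show "x * y \<in> F" using AB h_mem[of "A * B"] by (simp add: h_mult)
next
  fix x c assume "x \<in> F"
  then obtain A where A: "A \<in> carrier_mat n n" "x = h A"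
    by (auto simp: mem_iff)
  show "cstar x \<in> F" using A h_mem[of "cadj A"] by (simp add: h_cadj cadj_carrier)
  show "c *\<^sub>C x \<in> F" using A h_mem[of "c \<cdot>\<^sub>m A"] by (simp add: h_smult)
qed

lemma unit_mult_left:
  assumes "i < n" "A \<in> carrier_mat n n"
  shows "unit k i * A = mat n n (\<lambda>(r, c). if r = k then A $$ (i, c) else 0)"
proof (rule eq_matI)
  fix r c assume rc: "r < dim_row (mat n n (\<lambda>(r, c). if r = k then A $$ (i, c) else 0))"
    "c < dim_col (mat n n (\<lambda>(r, c). if r = k then A $$ (i, c) else 0))"
  then have "(unit k i * A) $$ (r, c) = (\<Sum>j<n. (if r = k \<and> j = i then 1 else 0) * A $$ (j, c))"
    using assms by (simp add: unit_def scalar_prod_def lessThan_atLeast0)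
  also have "\<dots> = (\<Sum>j<n. if j = i then (if r = k then A $$ (i, c) else 0) else 0)"
    by (intro sum.cong refl) auto
  finally show "(unit k i * A) $$ (r, c) = mat n n (\<lambda>(r, c). if r = k then A $$ (i, c) else 0) $$ (r, c)"
    using rc assms by simp
qed (use assms in \<open>auto simp: unit_def\<close>)

lemma unit_mult_right:
  assumes "j < n" "A \<in> carrier_mat n n"
  shows "A * unit j l = mat n n (\<lambda>(r, c). if c = l then A $$ (r, j) else 0)"
proof (rule eq_matI)
  fix r c assume rc: "r < dim_row (mat n n (\<lambda>(r, c). if c = l then A $$ (r, j) else 0))"
    "c < dim_col (mat n n (\<lambda>(r, c). if c = l then A $$ (r, j) else 0))"
  then have "(A * unit j l) $$ (r, c) = (\<Sum>k<n. A $$ (r, k) * (if k = j \<and> c = l then 1 else 0))"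
    using assms by (simp add: unit_def scalar_prod_def lessThan_atLeast0)
  also have "\<dots> = (\<Sum>k<n. if k = j then (if c = l then A $$ (r, j) else 0) else 0)"
    by (intro sum.cong refl) auto
  finally show "(A * unit j l) $$ (r, c) = mat n n (\<lambda>(r, c). if c = l then A $$ (r, j) else 0) $$ (r, c)"
    using rc assms by simp
qed (use assms in \<open>auto simp: unit_def\<close>)

lemma unit_compress:
  assumes "i < n" "j < n" "A \<in> carrier_mat n n"
  shows "unit k i * A * unit j l = A $$ (i, j) \<cdot>\<^sub>m unit k l"
  unfolding unit_mult_left[OF assms(1,3)]
  by (subst unit_mult_right) (auto simp: assms unit_def intro!: eq_matI)

definition g :: "nat \<Rightarrow> nat \<Rightarrow> 'a" where
  "g i j = h (unit i j)"

lemma g_compress: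
  assumes "i < n" "j < n" "A \<in> carrier_mat n n"
  shows "g k i * h A * g j l = A $$ (i, j) *\<^sub>C g k l"
proof -
  have "unit k i * A \<in> carrier_mat n n" using assms by (intro mult_carrier_mat) auto
  then have "h (unit k i * A * unit j l) = h (unit k i) * h A * h (unit j l)"
    using assms by (simp add: h_mult)
  then show ?thesis
    using unit_compress[OF assms, of k l] by (simp add: g_def h_smult)
qed

lemma matrix_units_g: "matrix_units n g"
  unfolding matrix_units_def
proof (intro conjI allI impI)
  fix i j k l assume ij: "i < n" "j < n" "k < n" "l < n"
  have "unit i j * unit k l = (if j = k then unit i l else 0\<^sub>m n n)"
    using ij by (subst unit_mult_right) (auto simp: unit_def intro!: eq_matI)
  then show "g i j * g k l = (if j = k then g i l else 0)"
    by (simp add: g_def h_mult[symmetric] h_zero)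
next
  fix i j assume "i < n" "j < n"
  then have "cadj (unit i j) = unit j i"
    by (auto simp: unit_def cadj_def intro!: eq_matI)
  then show "cstar (g i j) = g j i"
    by (simp add: g_def h_cadj[symmetric])
next
  define D where "D k = mat n n (\<lambda>(i, j). if i = j \<and> i < k then 1 else (0::complex))" for k
  have D: "D k \<in> carrier_mat n n" for k by (simp add: D_def)
  have "h (D k) = (\<Sum>i<k. g i i)" if "k \<le> n" for k
    using that
  proof (induction k)
    case 0
    have "D 0 = 0\<^sub>m n n" by (auto simp: D_def intro!: eq_matI)
    then show ?case by (simp add: h_zero)
  next
    case (Suc k)
    have "D (Suc k) = D k + unit k k" by (auto simp: D_def unit_def intro!: eq_matI)
    then show ?case using Suc D by (simp add: h_add g_def)
  qed
  from this[of n] have "h (D n) = (\<Sum>i<n. g i i)" by simp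
  moreover have "D n = 1\<^sub>m n" by (auto simp: D_def intro!: eq_matI)
  ultimately show "(\<Sum>i<n. g i i) = 1" by (simp add: h_one)
qed

lemma h_expand:
  assumes A: "A \<in> carrier_mat n n"
  shows "h A = (\<Sum>i<n. \<Sum>j<n. A $$ (i, j) *\<^sub>C g i j)"
proof -
  have "h A = (\<Sum>i<n. g i i) * h A * (\<Sum>j<n. g j j)"
    by (simp add: matrix_units_sum[OF matrix_units_g])
  also have "\<dots> = (\<Sum>i<n. \<Sum>j<n. g i i * h A * g j j)"
    by (simp add: sum_distrib_left sum_distrib_right) (rule sum.swap)
  finally show ?thesis
    by (simp add: g_compress A)
qed

lemma g_mem: "g i j \<in> F"
  by (simp add: g_def h_mem)

text \<open>Each matrix entry of x, moved to the corner at \<open>g 0 0\<close>, has to be scalar.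
  This describes F by finitely many continuous maps into one complex line, so closedness of F
  reduces to closedness of that line.\<close>

lemma mem_iff_compress:
  "x \<in> F \<longleftrightarrow> (\<forall>i<n. \<forall>j<n. \<exists>c. g 0 i * x * g j 0 = c *\<^sub>C g 0 0)"
proof
  assume "x \<in> F"
  then show "\<forall>i<n. \<forall>j<n. \<exists>c. g 0 i * x * g j 0 = c *\<^sub>C g 0 0"
    by (auto simp: mem_iff g_compress)
next
  assume "\<forall>i<n. \<forall>j<n. \<exists>c. g 0 i * x * g j 0 = c *\<^sub>C g 0 0"
  then obtain c where c: "\<And>i j. i < n \<Longrightarrow> j < n \<Longrightarrow> g 0 i * x * g j 0 = c i j *\<^sub>C g 0 0"
    by metis
  have n0: "0 < n" using n by simp
  have "g i i * x * g j j = c i j *\<^sub>C g i j" if "i < n" "j < n" for i j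
  proof -
    have "g i i * x * g j j = g i 0 * (g 0 i * x * g j 0) * g 0 j"
      using that n0 by (simp add: mult.assoc matrix_units_mult[OF matrix_units_g])
        (simp add: mult.assoc[symmetric] matrix_units_mult[OF matrix_units_g])
    also have "\<dots> = c i j *\<^sub>C g i j"
      using that n0 by (simp add: c scaleC_mult_left scaleC_mult_right matrix_units_mult[OF matrix_units_g])
    finally show ?thesis .
  qed
  then have "(\<Sum>i<n. \<Sum>j<n. g i i * x * g j j) = (\<Sum>i<n. \<Sum>j<n. c i j *\<^sub>C g i j)"
    by (intro sum.cong refl) auto
  moreover have "(\<Sum>i<n. \<Sum>j<n. g i i * x * g j j) = (\<Sum>i<n. g i i) * x * (\<Sum>j<n. g j j)"
    by (simp add: sum_distrib_left sum_distrib_right) (rule sum.swap)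
  ultimately have "x = (\<Sum>i<n. \<Sum>j<n. c i j *\<^sub>C g i j)"
    by (simp add: matrix_units_sum[OF matrix_units_g])
  also have "\<dots> = h (mat n n (\<lambda>(i, j). c i j))"
    by (subst h_expand) auto
  finally show "x \<in> F" by (simp add: h_mem)
qed

lemma closed_F: "closed F"
proof -
  have n0: "0 < n" using n by simp
  let ?L = "range (\<lambda>c. c *\<^sub>C g 0 0)"
  have "complete ?L"
  proof (rule complete_isometric_image)
    show "norm (g 0 0) > 0" using matrix_units_nonzero[OF matrix_units_g n0 n0] by simp
    show "\<forall>c\<in>UNIV. norm (g 0 0) * norm c \<le> norm (c *\<^sub>C g 0 0)" by (simp add: norm_scaleC)
  qed (auto simp: bounded_linear_scaleC complete_UNIV)
  then have L: "closed ?L" by (rule complete_imp_closed)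
  have "F = (\<Inter>i\<in>{..<n}. \<Inter>j\<in>{..<n}. (\<lambda>x. g 0 i * x * g j 0) -` ?L)"
    by (auto simp: mem_iff_compress image_iff)
  also have "closed \<dots>"
    by (intro closed_INT ballI closed_vimage L continuous_intros)
  finally show ?thesis .
qed

text \<open>Finiteness of the matrix algebra; the finiteness of the limit algebra rests on
  it.\<close>

lemma right_inverse_if_left_inverse:
  assumes "x \<in> F" "y \<in> F" "x * y = 1"
  shows "y * x = 1"
proof -
  obtain A B where AB: "A \<in> carrier_mat n n" "B \<in> carrier_mat n n" "x = h A" "y = h B"
    using assms by (auto simp: mem_iff)
  have "h (A * B) = h (1\<^sub>m n)" using AB assms by (simp add: h_mult h_one)
  then have "A * B = 1\<^sub>m n" using AB by (subst (asm) h_inj) auto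
  then have "B * A = 1\<^sub>m n" using AB mat_mult_left_right_inverse by blast
  then show ?thesis using AB h_mult[of B A] by (simp add: h_one)
qed

lemma unimodular_resolvent:
  assumes "x \<in> F"
  obtains c y where "cmod c = 1" "y * (c *\<^sub>C 1 + x) = 1" "(c *\<^sub>C 1 + x) * y = 1"
proof -
  obtain A where A: "A \<in> carrier_mat n n" "x = h A"
    using assms by (auto simp: mem_iff)
  \<comment> \<open>A quarter of the unit circle, parametrised injectively by the real part, is
    infinite, whereas the spectrum is finite; so some point of the arc lies outside it.\<close>
  have "inj_on (\<lambda>x. - Complex x (sqrt (1 - x\<^sup>2))) {0..1}"
    by (auto simp: inj_on_def)
  then have "infinite ((\<lambda>x. - Complex x (sqrt (1 - x\<^sup>2))) ` {0..1})"
    by (simp add: finite_image_iff)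
  then obtain b where "b \<in> (\<lambda>x. - Complex x (sqrt (1 - x\<^sup>2))) ` {0..1}" "b \<notin> spectrum A"
    using card_finite_spectrum(1)[OF A(1)] by (meson finite_subset subsetI)
  then obtain t where t: "0 \<le> t" "t \<le> 1" "- Complex t (sqrt (1 - t\<^sup>2)) \<notin> spectrum A"
    by auto
  define c where "c = Complex t (sqrt (1 - t\<^sup>2))"
  have c: "cmod c = 1" "- c \<notin> spectrum A"
    using t by (auto simp: c_def cmod_def power_le_one)
  let ?B = "char_matrix A (- c)"
  have B: "?B \<in> carrier_mat n n" using A by simp
  have hB: "h ?B = c *\<^sub>C 1 + x"
    using A h_add[of A "c \<cdot>\<^sub>m 1\<^sub>m n"] by (simp add: char_matrix_def h_smult h_one add.commute)
  have "det ?B \<noteq> 0"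
    using c(2) A eigenvalue_det[OF A(1)] by (auto simp: spectrum_def)
  from det_non_zero_imp_unit[OF B this, of undefined]
  obtain C where C: "C \<in> carrier_mat n n" "C * ?B = 1\<^sub>m n" "?B * C = 1\<^sub>m n"
    by (auto simp: Units_def ring_mat_def)
  show ?thesis
    using that[OF c(1), of "h C"] C B h_mult[of C ?B] h_mult[of ?B C] by (simp add: hB h_one)
qed

end

lemma matrix_subalgebra_obtain:
  assumes "matrix_subalgebra F n"
  obtains h where "matrix_algebra n h F"
proof -
  from assms obtain h :: "complex mat \<Rightarrow> 'a" where
    "n \<ge> 1" "bij_betw h (carrier_mat n n) F"
    "\<forall>A\<in>carrier_mat n n. \<forall>B\<in>carrier_mat n n. h (A + B) = h A + h B \<and> h (A * B) = h A * h B"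
    "\<forall>c. \<forall>A\<in>carrier_mat n n. h (c \<cdot>\<^sub>m A) = c *\<^sub>C h A"
    "\<forall>A\<in>carrier_mat n n. h (cadj A) = cstar (h A)" "h (1\<^sub>m n) = 1"
    unfolding matrix_subalgebra_def by blast
  then have "matrix_algebra n h F" by unfold_locales auto
  then show ?thesis by (rule that)
qed

subsection \<open>Projections in matrix subalgebras\<close>

text \<open>Projections are perturbed through the symmetries \<^term>\<open>1 - 2 *\<^sub>R p\<close>: a self-adjoint element
  near a symmetry is made into one by \<open>x \<mapsto> x (x\<^sup>2)\<^sup>-\<^sup>1\<^sup>/\<^sup>2\<close>.\<close>

lemma projection_symmetry:
  assumes "projection p"
  defines "g \<equiv> 1 - 2 *\<^sub>R p"
  shows "g * g = 1" "cstar g = g" "unitary g" "p = (1 / 2) *\<^sub>R (1 - g)"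
proof -
  show 1: "g * g = 1"
    using assms by (simp add: projection_def algebra_simps scaleR_2)
  show 2: "cstar g = g"
    using assms by (simp add: projection_def cstar_diff cstar_scaleR)
  show "unitary g" using 1 2 by (simp add: unitary_def)
  show "p = (1 / 2) *\<^sub>R (1 - g)" by (simp add: g_def)
qed

lemma symmetry_projection:
  assumes "g * g = 1" "cstar g = g"
  shows "projection ((1 / 2) *\<^sub>R (1 - g))"
proof -
  have "((1 / 2) *\<^sub>R (1 - g)) * ((1 / 2) *\<^sub>R (1 - g)) = (1 / 4) *\<^sub>R (1 - g - g + g * g)"
    by (simp add: algebra_simps)
  also have "\<dots> = (1 / 2) *\<^sub>R (1 - g)"
    by (simp add: assms algebra_simps scaleR_2[symmetric])
  finally show ?thesis
    by (simp add: projection_def cstar_scaleR cstar_diff assms)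
qed

text \<open>The self-adjoint part \<open>b\<close> of a is normalised to a symmetry \<open>g\<close>
  in S. It is close to the symmetry \<open>g0\<close> of p, and two close symmetries are unitarily
  equivalent through a polar part.\<close>

lemma projection_near_closed_subalgebra:
  assumes S: "star_subalgebra S" "closed S" and p: "projection p"
    and a: "a \<in> S" "norm (a - (1 - 2 *\<^sub>R p)) \<le> 1 / 16"
  obtains u where "unitary u" "projection (cstar u * p * u)" "cstar u * p * u \<in> S"
proof -
  define g0 where "g0 = 1 - 2 *\<^sub>R p"
  note g0 = projection_symmetry[OF p, folded g0_def]
  define b where "b = (1 / 2) *\<^sub>R (a + cstar a)"
  have bS: "b \<in> S" by (simp add: b_def star_subalgebraD[OF S(1)] a(1))
  have bsa: "cstar b = b" by (simp add: b_def cstar_scaleR cstar_add cstar_cstar add.commute)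
  have "b - g0 = (1 / 2) *\<^sub>R ((a - g0) + cstar (a - g0))"
    by (simp add: b_def cstar_diff g0 algebra_simps scaleR_2[symmetric])
  then have "norm (b - g0) \<le> (1 / 2) * (norm (a - g0) + norm (cstar (a - g0)))"
    using norm_triangle_ineq[of "a - g0" "cstar (a - g0)"] by simp
  then have bg0: "norm (b - g0) \<le> 1 / 16" using a by (simp add: g0_def)
  define s where "s = 1 - b * b"
  have s: "norm s \<le> 1 / 4"
    using almost_unitary_bounds(1)[OF g0(3) bg0] by (simp add: s_def bsa)
  have s1: "norm s < 1" using s by simp
  have sS: "s \<in> S" by (simp add: s_def star_subalgebraD[OF S(1)] bS)
  define R where "R = inv_sqrt_one_minus s"
  have RS: "R \<in> S" unfolding R_def by (rule inv_sqrt_in_star_subalgebra[OF S s1 sS])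
  have ssa: "cstar s = s" by (simp add: s_def cstar_diff cstar_mult bsa)
  have Rsa: "cstar R = R" unfolding R_def by (simp add: cstar_inv_sqrt s1 ssa)
  have bR: "b * R = R * b"
    unfolding R_def by (rule inv_sqrt_commute[OF s1]) (simp add: s_def algebra_simps)
  define g where "g = b * R"
  have gS: "g \<in> S" by (simp add: g_def star_subalgebraD[OF S(1)] bS RS)
  have gsa: "cstar g = g" by (simp add: g_def cstar_mult bsa Rsa bR)
  have "g * g = R * (b * b) * R"
    unfolding g_def by (metis bR mult.assoc)
  also have "\<dots> = 1"
    using inv_sqrt_square_inverse(3)[OF s1] by (simp add: s_def R_def)
  finally have gg: "g * g = 1" .
  have "norm b \<le> 17 / 16"
    using norm_triangle_ineq[of g0 "b - g0"] bg0 unitary_norm[OF g0(3)] by simp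
  then have "norm (b * (R - 1)) \<le> (17 / 16) * (1 / 3)"
    using inv_sqrt_near_1[OF s] unfolding R_def
    by (intro order_trans[OF norm_mult_ineq] mult_mono) auto
  moreover have "norm (g - g0) = norm (b * (R - 1) + (b - g0))" by (simp add: g_def algebra_simps)
  \<comment> \<open>The errors add up to 17/48 + 1/16 = 5/12.\<close>
  ultimately have gg0: "norm (g - g0) \<le> 1 / 2"
    using norm_triangle_ineq[of "b * (R - 1)" "b - g0"] bg0 by linarith
  \<comment> \<open>This average exchanges the symmetries, g0 (1 + g0 g) = g0 + g = (1 + g0 g) g,
    and it equals 1 when g = g0.\<close>
  define x where "x = (1 / 2) *\<^sub>R (1 + g0 * g)"
  have "x - 1 = (1 / 2) *\<^sub>R (g0 * (g - g0))"
    by (simp add: x_def algebra_simps g0 scaleR_2[symmetric])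
  also have "norm \<dots> \<le> (1 / 2) * (norm g0 * norm (g - g0))"
    using norm_mult_ineq[of g0 "g - g0"] by simp
  also have "\<dots> \<le> 1 / 4" using gg0 unitary_norm[OF g0(3)] by simp
  finally have x1: "norm (x - 1) \<le> 1 / 4" .
  have int: "g0 * x = x * g" 
    by (simp add: x_def distrib_left distrib_right mult.assoc gg) (simp add: mult.assoc[symmetric] g0 add.commute)
  have int': "g * cstar x = cstar x * g0"
    using arg_cong[OF int, of cstar] by (simp add: cstar_mult g0 gsa)
  define u where "u = polar_part x"
  have u: "unitary u" unfolding u_def by (rule polar_part_near_1(1)[OF x1])
  have "g0 * u = u * g" unfolding u_def by (rule polar_part_near_1(2)[OF x1 int int'])
  then have "cstar u * g0 * u = g" using u by (simp add: mult.assoc unitary_cancel)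
  then have *: "cstar u * p * u = (1 / 2) *\<^sub>R (1 - g)"
    by (subst g0(4)) (simp add: algebra_simps unitaryD[OF u])
  show ?thesis
  proof (rule that[OF u])
    show "projection (cstar u * p * u)" unfolding * by (rule symmetry_projection[OF gg gsa])
    show "cstar u * p * u \<in> S" unfolding * by (simp add: star_subalgebraD[OF S(1)] gS)
  qed
qed

section \<open>Rank-one projections, trace and comparison\<close>

context matrix_algebra
begin

lemma g_assoc:
  "i < n \<Longrightarrow> j < n \<Longrightarrow> k < n \<Longrightarrow> l < n \<Longrightarrow> g i j * (g k l * x) = (if j = k then g i l * x else 0)"
  by (rule matrix_units_mult_assoc[OF matrix_units_g])

lemmas g_mult = matrix_units_mult[OF matrix_units_g]
lemmas g_cstar = matrix_units_cstar[OF matrix_units_g]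

lemma compress_coeff:
  assumes "x \<in> F" "i < n" "j < n"
  obtains c where "g 0 i * x * g j 0 = c *\<^sub>C g 0 0"
  using assms by (auto simp: mem_iff_compress)

text \<open>Writing 1 as the sum of the \<open>g i 0 * g 0 i\<close> routes a product through the
  corner at \<open>g 0 0\<close>, where compressions of elements of F are scalars.\<close>

lemma insert_one: "x * y = (\<Sum>i<n. x * g i 0 * (g 0 i * y))"
proof -
  have "x * y = x * (\<Sum>i<n. g i i) * y"
    by (simp add: matrix_units_sum[OF matrix_units_g])
  also have "\<dots> = (\<Sum>i<n. x * g i i * y)"
    by (simp add: sum_distrib_left sum_distrib_right)
  also have "\<dots> = (\<Sum>i<n. x * g i 0 * (g 0 i * y))"
    using n by (intro sum.cong refl) (simp add: mult.assoc g_assoc)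
  finally show ?thesis .
qed

text \<open>Such an x is a column vector with entries \<open>c i\<close>. Its squared length appears
  twice, as the inner product \<open>cstar x * x\<close> and as the trace of
  \<open>x * cstar x\<close>; hence a unit column yields a projection of trace one.\<close>

lemma column_square:
  assumes "x \<in> F" "x * g 0 0 = x"
  obtains c where "cstar x * x = (\<Sum>i<n. (cmod (c i))\<^sup>2) *\<^sub>R g 0 0"
    "(\<Sum>i<n. g 0 i * (x * cstar x) * g i 0) = (\<Sum>i<n. (cmod (c i))\<^sup>2) *\<^sub>R g 0 0"
proof -
  have n0: "0 < n" using n by simp
  have "\<exists>c. g 0 i * x = c *\<^sub>C g 0 0" if "i < n" for i
    using compress_coeff[OF assms(1) that n0] assms(2) by (metis mult.assoc)
  then obtain c where c: "\<And>i. i < n \<Longrightarrow> g 0 i * x = c i *\<^sub>C g 0 0" by metis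
  have c': "cstar x * g i 0 = cnj (c i) *\<^sub>C g 0 0" if "i < n" for i
    using arg_cong[OF c[OF that], of cstar] that n0 by (simp add: cstar_mult cstar_scaleC g_cstar)
  have sq: "c i * cnj (c i) = (complex_of_real (cmod (c i)))\<^sup>2"
    "cnj (c i) * c i = (complex_of_real (cmod (c i)))\<^sup>2" for i
    by (simp_all only: complex_norm_square of_real_power[symmetric] mult.commute)
  show ?thesis
  proof (rule that)
    have "cstar x * x = (\<Sum>i<n. (cstar x * g i 0) * (g 0 i * x))"
      by (rule insert_one)
    also have "\<dots> = (\<Sum>i<n. (cmod (c i))\<^sup>2 *\<^sub>R g 0 0)"
      using n0 by (intro sum.cong refl)
        (simp add: c c' scaleC_mult_left scaleC_mult_right scaleC_scaleC g_mult scaleR_scaleC sq)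
    finally show "cstar x * x = (\<Sum>i<n. (cmod (c i))\<^sup>2) *\<^sub>R g 0 0"
      by (simp add: scaleR_sum_left)
    have "(\<Sum>i<n. g 0 i * (x * cstar x) * g i 0) = (\<Sum>i<n. (g 0 i * x) * (cstar x * g i 0))"
      by (simp add: mult.assoc)
    also have "\<dots> = (\<Sum>i<n. (cmod (c i))\<^sup>2 *\<^sub>R g 0 0)"
      using n0 by (intro sum.cong refl)
        (simp add: c c' scaleC_mult_left scaleC_mult_right scaleC_scaleC g_mult scaleR_scaleC sq)
    finally show "(\<Sum>i<n. g 0 i * (x * cstar x) * g i 0) = (\<Sum>i<n. (cmod (c i))\<^sup>2) *\<^sub>R g 0 0"
      by (simp add: scaleR_sum_left)
  qed
qed

text \<open>\<^term>\<open>\<Sum>i<n. g 0 i * x * g i 0\<close> is the trace of \<open>x\<close> times \<^term>\<open>g 0 0\<close>.\<close>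

lemma projection_trace_nonneg:
  assumes p: "projection p" "p \<in> F"
  obtains r where "r \<ge> 0" "(\<Sum>i<n. g 0 i * p * g i 0) = r *\<^sub>R g 0 0"
proof -
  have n0: "0 < n" using n by simp
  \<comment> \<open>Since p = p^* p, the i-th diagonal entry is the squared length of the i-th
    column \<open>p * g i 0\<close>.\<close>
  have "\<exists>r\<ge>0. g 0 i * p * g i 0 = r *\<^sub>R g 0 0" if i: "i < n" for i
  proof -
    have "p * g i 0 \<in> F" by (simp add: star_subalgebraD[OF star_subalgebra] g_mem p)
    moreover have "p * g i 0 * g 0 0 = p * g i 0" using i n0 by (simp add: mult.assoc g_mult)
    ultimately obtain c where
      "cstar (p * g i 0) * (p * g i 0) = (\<Sum>k<n. (cmod (c k))\<^sup>2) *\<^sub>R g 0 0"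
      by (rule column_square)
    moreover have "cstar (p * g i 0) * (p * g i 0) = g 0 i * (p * p) * g i 0"
    proof -
      have "cstar p = p" using p by (simp add: projection_def)
      then show ?thesis using i n0 by (simp add: cstar_mult g_cstar mult.assoc)
    qed
    ultimately show ?thesis
      using p by (intro exI[of _ "\<Sum>k<n. (cmod (c k))\<^sup>2"]) (auto simp: projection_def sum_nonneg)
  qed
  then obtain r where r: "\<And>i. i < n \<Longrightarrow> r i \<ge> 0 \<and> g 0 i * p * g i 0 = r i *\<^sub>R g 0 0"
    by metis
  show ?thesis
    by (rule that[of "\<Sum>i<n. r i"]) (auto intro!: sum_nonneg simp: r scaleR_sum_left)
qed

text \<open>The columns \<open>p * g i 0\<close> determine p, so one of them is nonzero. Normalised,
  it is a unit vector in the range of p; removing its rank-one projection lowers the trace by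
  exactly one.\<close>

lemma rank_one_subprojection:
  assumes p: "projection p" "p \<in> F" "p \<noteq> 0"
  obtains \<xi> where "\<xi> \<in> F" "\<xi> * g 0 0 = \<xi>" "cstar \<xi> * \<xi> = g 0 0" "p * \<xi> = \<xi>"
    "projection (p - \<xi> * cstar \<xi>)" "p - \<xi> * cstar \<xi> \<in> F"
    "(\<Sum>i<n. g 0 i * (\<xi> * cstar \<xi>) * g i 0) = g 0 0"
proof -
  have n0: "0 < n" using n by simp
  note S = star_subalgebraD[OF star_subalgebra]
  have "\<exists>i<n. p * g i 0 \<noteq> 0"
  proof (rule ccontr)
    assume "\<not> ?thesis"
    then have "p * 1 = 0" by (subst insert_one) simp
    then show False using p by simp
  qed
  then obtain i where i: "i < n" "p * g i 0 \<noteq> 0" by blast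
  define x where "x = p * g i 0"
  have xF: "x \<in> F" using p g_mem S by (simp add: x_def)
  have xg: "x * g 0 0 = x" using i n0 by (simp add: x_def mult.assoc g_mult)
  obtain c where c: "cstar x * x = (\<Sum>k<n. (cmod (c k))\<^sup>2) *\<^sub>R g 0 0"
    using xF xg by (rule column_square)
  define r where "r = (\<Sum>k<n. (cmod (c k))\<^sup>2)"
  have r0: "r \<ge> 0" by (simp add: r_def sum_nonneg)
  have "r \<noteq> 0"
    using c i(2) eq_zero_if_cstar_mult_zero[of x] by (auto simp: r_def[symmetric] x_def)
  then have r: "r > 0" using r0 by simp
  define \<xi> where "\<xi> = (1 / sqrt r) *\<^sub>R x"
  have \<xi>: "cstar \<xi> * \<xi> = g 0 0"
    using r by (simp add: \<xi>_def cstar_scaleR c r_def[symmetric])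
  have \<xi>F: "\<xi> \<in> F" using xF S by (simp add: \<xi>_def)
  have \<xi>g: "\<xi> * g 0 0 = \<xi>" by (simp add: \<xi>_def xg)
  have p\<xi>: "p * \<xi> = \<xi>" using p by (simp add: \<xi>_def x_def projection_def mult.assoc[symmetric])
  have \<xi>p: "cstar \<xi> * p = cstar \<xi>"
    using arg_cong[OF p\<xi>, of cstar] p by (simp add: cstar_mult projection_def)
  have gx: "g 0 0 * cstar \<xi> = cstar \<xi>"
    using arg_cong[OF \<xi>g, of cstar] n0 by (simp add: cstar_mult g_cstar)
  have \<xi>\<xi>: "\<xi> * cstar \<xi> * (\<xi> * cstar \<xi>) = \<xi> * cstar \<xi>"
    by (metis \<xi> \<xi>g mult.assoc)
  obtain d where d: "cstar \<xi> * \<xi> = (\<Sum>k<n. (cmod (d k))\<^sup>2) *\<^sub>R g 0 0"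
    "(\<Sum>i<n. g 0 i * (\<xi> * cstar \<xi>) * g i 0) = (\<Sum>k<n. (cmod (d k))\<^sup>2) *\<^sub>R g 0 0"
    using \<xi>F \<xi>g by (rule column_square)
  show ?thesis
  proof (rule that[OF \<xi>F \<xi>g \<xi> p\<xi>])
    have "(p - \<xi> * cstar \<xi>) * (p - \<xi> * cstar \<xi>) = p * p - p * \<xi> * cstar \<xi> - \<xi> * (cstar \<xi> * p) + \<xi> * cstar \<xi> * (\<xi> * cstar \<xi>)"
      by (simp add: algebra_simps)
    also have "\<dots> = p - \<xi> * cstar \<xi>"
      unfolding \<xi>\<xi> p\<xi> \<xi>p using p by (simp add: projection_def)
    finally show "projection (p - \<xi> * cstar \<xi>)"
      using p by (simp add: projection_def cstar_diff cstar_mult cstar_cstar)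
    show "p - \<xi> * cstar \<xi> \<in> F" using p \<xi>F S by simp
    show "(\<Sum>i<n. g 0 i * (\<xi> * cstar \<xi>) * g i 0) = g 0 0" using d \<xi> by simp
  qed
qed

text \<open>The condition on w says that it is a partial isometry from one projection into the
  other. Rank-one pieces are removed from both until one projection vanishes, and
  \<open>extend\<close> restores them by adding \<eta> \<xi>^* to w. The trace is known only as a
  nonnegative real, so the induction runs over a natural number above it.\<close>

lemma projections_comparable:
  assumes "projection p" "p \<in> F" "projection q" "q \<in> F"
  shows "\<exists>w. (cstar w * w = p \<and> q * w = w) \<or> (cstar w * w = q \<and> p * w = w)"
proof -
  have n0: "0 < n" using n by simp
  have extend: "cstar (w + \<eta> * cstar \<xi>) * (w + \<eta> * cstar \<xi>) = p \<and> q * (w + \<eta> * cstar \<xi>) = w + \<eta> * cstar \<xi>"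
    if pq: "projection q" "cstar w * w = p - \<xi> * cstar \<xi>" "(q - \<eta> * cstar \<eta>) * w = w"
      and \<xi>: "\<xi> * g 0 0 = \<xi>" and \<eta>: "\<eta> * g 0 0 = \<eta>" "cstar \<eta> * \<eta> = g 0 0" "q * \<eta> = \<eta>"
    for p q \<xi> \<eta> w
  proof -
    have \<eta>q: "cstar \<eta> * q = cstar \<eta>"
      using arg_cong[OF \<eta>(3), of cstar] pq by (simp add: cstar_mult projection_def)
    \<comment> \<open>The range of w lies under q - \<eta> \<eta>^*, to which \<eta> is orthogonal;
      this removes the cross terms.\<close>
    have "cstar \<eta> * (q - \<eta> * cstar \<eta>) = cstar \<eta> - (cstar \<eta> * \<eta>) * cstar \<eta>"
      by (simp add: right_diff_distrib \<eta>q mult.assoc)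
    also have "\<dots> = 0"
      using arg_cong[OF \<eta>(1), of cstar] n0 by (simp add: \<eta>(2) cstar_mult g_cstar)
    finally have \<eta>w: "cstar \<eta> * w = 0" by (metis pq(3) mult.assoc mult_zero_left)
    have w\<eta>: "cstar w * \<eta> = 0"
      using arg_cong[OF \<eta>w, of cstar] by (simp add: cstar_mult cstar_cstar)
    have "cstar (w + \<eta> * cstar \<xi>) * (w + \<eta> * cstar \<xi>)
        = cstar w * w + (cstar w * \<eta>) * cstar \<xi> + \<xi> * (cstar \<eta> * w) + \<xi> * (cstar \<eta> * \<eta>) * cstar \<xi>"
      by (simp add: cstar_add cstar_mult cstar_cstar algebra_simps)
    also have "\<dots> = p" by (simp add: w\<eta> \<eta>w \<eta> \<xi> pq)
    moreover have "q * w = w"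
    proof -
      have "q * (q - \<eta> * cstar \<eta>) = q - \<eta> * cstar \<eta>"
        using pq(1) \<eta>(3) by (simp add: projection_def right_diff_distrib mult.assoc[symmetric])
      then show ?thesis by (metis pq(3) mult.assoc)
    qed
    ultimately show ?thesis
      using \<eta>(3) by (simp add: distrib_left mult.assoc[symmetric])
  qed
  have main: "\<lbrakk>projection p; p \<in> F; projection q; q \<in> F; (\<Sum>i<n. g 0 i * p * g i 0) = r *\<^sub>R g 0 0; r < real k\<rbrakk>
    \<Longrightarrow> \<exists>w. (cstar w * w = p \<and> q * w = w) \<or> (cstar w * w = q \<and> p * w = w)" for r k p q
  proof (induction k arbitrary: r p q)
    case 0
    \<comment> \<open>A trace below 0 contradicts nonnegativity, so the induction starts from an
      impossible case.\<close>
    obtain r' where "r' \<ge> 0" "(\<Sum>i<n. g 0 i * p * g i 0) = r' *\<^sub>R g 0 0"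
      using 0(1,2) by (rule projection_trace_nonneg)
    then have "r = r'" using 0(5) matrix_units_nonzero[OF matrix_units_g n0 n0] by simp
    then show ?case using 0 \<open>r' \<ge> 0\<close> by simp
  next
    case (Suc k)
    consider "p = 0" | "q = 0" | "p \<noteq> 0" "q \<noteq> 0" by blast
    then show ?case
    proof cases
      case 1
      then show ?thesis by (intro exI[of _ 0]) simp
    next
      case 2
      then show ?thesis by (intro exI[of _ 0]) simp
    next
      case 3
      obtain \<xi> where \<xi>: "\<xi> \<in> F" "\<xi> * g 0 0 = \<xi>" "cstar \<xi> * \<xi> = g 0 0" "p * \<xi> = \<xi>"
        "projection (p - \<xi> * cstar \<xi>)" "p - \<xi> * cstar \<xi> \<in> F"
        "(\<Sum>i<n. g 0 i * (\<xi> * cstar \<xi>) * g i 0) = g 0 0"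
        using Suc.prems(1,2) 3(1) by (rule rank_one_subprojection)
      obtain \<eta> where \<eta>: "\<eta> \<in> F" "\<eta> * g 0 0 = \<eta>" "cstar \<eta> * \<eta> = g 0 0" "q * \<eta> = \<eta>"
        "projection (q - \<eta> * cstar \<eta>)" "q - \<eta> * cstar \<eta> \<in> F"
        "(\<Sum>i<n. g 0 i * (\<eta> * cstar \<eta>) * g i 0) = g 0 0"
        using Suc.prems(3,4) 3(2) by (rule rank_one_subprojection)
      have "(\<Sum>i<n. g 0 i * (p - \<xi> * cstar \<xi>) * g i 0)
          = (\<Sum>i<n. g 0 i * p * g i 0) - (\<Sum>i<n. g 0 i * (\<xi> * cstar \<xi>) * g i 0)"
        by (simp only: right_diff_distrib left_diff_distrib sum_subtractf)
      also have "\<dots> = (r - 1) *\<^sub>R g 0 0"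
        by (simp add: Suc.prems(5) \<xi>(7) scaleR_left_diff_distrib)
      finally obtain w where "(cstar w * w = p - \<xi> * cstar \<xi> \<and> (q - \<eta> * cstar \<eta>) * w = w) \<or>
          (cstar w * w = q - \<eta> * cstar \<eta> \<and> (p - \<xi> * cstar \<xi>) * w = w)"
        using Suc.IH[OF \<xi>(5,6) \<eta>(5,6)] Suc.prems(6) by fastforce
      then show ?thesis
        using extend[OF Suc.prems(3) _ _ \<xi>(2) \<eta>(2-4)] extend[OF Suc.prems(1) _ _ \<eta>(2) \<xi>(2-4)] by blast
    qed
  qed
  obtain r where r: "(\<Sum>i<n. g 0 i * p * g i 0) = r *\<^sub>R g 0 0"
    using assms(1,2) by (rule projection_trace_nonneg)
  obtain k :: nat where "r < real k" using reals_Archimedean2 by blast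
  then show ?thesis using main[OF assms r] by blast
qed

text \<open>As \<open>cstar x * x\<close> is near 1, x has a left inverse in F, which is two-sided
  because F is a matrix algebra. Since \<open>cstar s * x\<close> is near 1 too, it is invertible,
  and \<open>cstar s\<close> acquires a left inverse; its right inverse s must then coincide with
  that one.\<close>

lemma isometry_near_imp_unitary:
  assumes s: "cstar s * s = 1" and x: "x \<in> F" "norm (x - s) \<le> 1 / 4"
  shows "unitary s"
proof -
  note S = star_subalgebraD[OF star_subalgebra]
  have ns: "norm s = 1" by (rule norm_isometry[OF s])
  have nx: "norm x \<le> 5 / 4"
    using norm_triangle_ineq[of s "x - s"] x(2) ns by simp
  have cxs: "norm (cstar x - cstar s) \<le> 1 / 4" using x(2) by (metis cstar_diff norm_cstar)
  have "1 - cstar x * x = - ((cstar x - cstar s) * x + cstar s * (x - s))"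
    using s by (simp add: algebra_simps)
  also have "norm \<dots> \<le> norm (cstar x - cstar s) * norm x + norm (cstar s) * norm (x - s)"
    unfolding norm_minus_cancel by (rule order_trans[OF norm_triangle_ineq]) (intro add_mono norm_mult_ineq)
  also have "\<dots> \<le> (1 / 4) * (5 / 4) + 1 * (1 / 4)"
    using cxs x(2) nx ns by (intro add_mono mult_mono) auto
  finally have lt: "norm (1 - cstar x * x) < 1" by simp
  define R where "R = inv_sqrt_one_minus (1 - cstar x * x)"
  have "1 - cstar x * x \<in> F" using S x by simp
  then have "R \<in> F" unfolding R_def by (rule inv_sqrt_in_star_subalgebra[OF star_subalgebra closed_F lt])
  define y where "y = R * R * cstar x"
  have yF: "y \<in> F" using S x \<open>R \<in> F\<close> by (simp add: y_def)
  have yx: "y * x = 1"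
    using inv_sqrt_square_inverse(1)[OF lt] by (simp add: y_def R_def mult.assoc)
  have xy: "x * y = 1" by (rule right_inverse_if_left_inverse[OF yF x(1) yx])
  have "1 - cstar s * x = - (cstar s * (x - s))" using s by (simp add: algebra_simps)
  then have "norm (1 - cstar s * x) \<le> norm (cstar s) * norm (x - s)"
    using norm_mult_ineq[of "cstar s" "x - s"] by simp
  then have "norm (1 - cstar s * x) < 1" using x(2) ns by simp
  then obtain z where z: "z * (cstar s * x) = 1" "(cstar s * x) * z = 1"
    by (rule neumann_inverse)
  have l: "(x * z) * cstar s = 1"
  proof -
    have "(x * z) * cstar s = x * (z * (cstar s * x)) * y"
      by (simp add: mult.assoc xy)
    then show ?thesis by (simp add: z xy)
  qed
  then have "x * z = s" by (metis s mult.assoc mult.right_neutral mult.left_neutral)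
  then show ?thesis using l s by (simp add: unitary_def)
qed

end

subsection \<open>Unitary equivalence and connectedness in the limit algebra\<close>

text \<open>Cayley transform: the path is
  \<^term>\<open>((1 - s) + (1 + s) * u) * inverse ((1 + s) + (1 - s) * u)\<close>; the denominator is invertible by
  the Neumann series for \<open>s > 0\<close> and by assumption for \<open>s = 0\<close>.\<close>

lemma unitary_path_Cayley:
  fixes u :: "'a::cstar_algebra_1"
  assumes u: "unitary u" and k: "k * (1 + u) = 1" "(1 + u) * k = 1"
  obtains w where "continuous_on {0..1::real} w" "w 0 = 1" "w 1 = u"
    "\<And>s. s \<in> {0..1} \<Longrightarrow> unitary (w s)"
    "\<And>s x. s \<in> {0..1} \<Longrightarrow> x * u = u * x \<Longrightarrow> x * w s = w s * x"
proof -
  define D where "D s = (1 + s) *\<^sub>R 1 + (1 - s) *\<^sub>R u" for s :: real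
  define N where "N s = (1 - s) *\<^sub>R 1 + (1 + s) *\<^sub>R u" for s :: real
  have "\<exists>y. y * D s = 1 \<and> D s * y = 1" if s: "s \<in> {0..1}" for s
  proof (cases "s = 0")
    case True
    then show ?thesis using k by (auto simp: D_def)
  next
    case False
    have "1 - (1 / (1 + s)) *\<^sub>R D s = - (((1 - s) / (1 + s)) *\<^sub>R u)"
      using s by (simp add: D_def scaleR_add_right)
    then have "norm (1 - (1 / (1 + s)) *\<^sub>R D s) = (1 - s) / (1 + s)"
      using s unitary_norm[OF u] by simp
    also have "\<dots> < 1" using s False by simp
    finally obtain y where "y * ((1 / (1 + s)) *\<^sub>R D s) = 1" "((1 / (1 + s)) *\<^sub>R D s) * y = 1"
      by (rule neumann_inverse)
    then show ?thesis by (intro exI[of _ "(1 / (1 + s)) *\<^sub>R y"]) auto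
  qed
  then obtain K where K: "\<And>s. s \<in> {0..1} \<Longrightarrow> K s * D s = 1 \<and> D s * K s = 1"
    by metis
  have com: "x * D s = D s * x" "x * N s = N s * x" if "x * u = u * x" for x s
    using that by (simp_all add: D_def N_def algebra_simps)
  have comK: "x * K s = K s * x" if "x * D s = D s * x" "s \<in> {0..1}" for x s
    using K[OF that(2)] that(1) by (metis mult.assoc mult.left_neutral mult.right_neutral)
  have ucu: "cstar u * u = u * cstar u" using u by (simp add: unitary_def)
  have cD: "cstar (D s) = (1 + s) *\<^sub>R 1 + (1 - s) *\<^sub>R cstar u" for s
    by (simp add: D_def cstar_add cstar_scaleR)
  have DD: "cstar (D s) * D s = D s * cstar (D s)" for s
    unfolding cD unfolding D_def by (simp add: algebra_simps ucu)
  \<comment> \<open>N = u D^* with D normal, so N^* N = D^* D; this is why the quotient of N by D is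
    unitary.\<close>
  have ND: "N s = u * cstar (D s)" "N s = cstar (D s) * u" for s
    unfolding cD N_def using u by (simp_all add: algebra_simps unitary_def)
  have NN: "cstar (N s) * N s = cstar (D s) * D s" "N s * cstar (N s) = D s * cstar (D s)" for s
  proof -
    have "cstar (N s) * N s = D s * (cstar u * u) * cstar (D s)"
      unfolding ND(1) by (simp add: cstar_mult cstar_cstar mult.assoc)
    then show "cstar (N s) * N s = cstar (D s) * D s" using u by (simp add: unitary_def DD)
    have "N s * cstar (N s) = cstar (D s) * (u * cstar u) * D s"
      unfolding ND(2) by (simp add: cstar_mult cstar_cstar mult.assoc)
    then show "N s * cstar (N s) = D s * cstar (D s)" using u by (simp add: unitary_def DD)
  qed
  define w where "w s = N s * K s" for s
  show ?thesis
  proof (rule that[of w])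
    have "continuous_on {0..1} K"
      by (rule continuous_on_inverse_elements[of _ D]) (use K in \<open>auto simp: D_def intro!: continuous_intros\<close>)
    then show "continuous_on {0..1} w"
      unfolding w_def N_def by (intro continuous_intros)
    have "D 0 = N 0" "D 1 = 2 *\<^sub>R 1" "N 1 = 2 *\<^sub>R u" by (auto simp: D_def N_def)
    then show "w 0 = 1" "w 1 = u"
      using K[of 0] K[of 1] by (auto simp: w_def) (metis mult.right_neutral mult_scaleR_right)
  next
    fix s :: real assume s: "s \<in> {0..1}"
    have "cstar (w s) * w s = cstar (K s) * (cstar (N s) * N s) * K s"
      by (simp add: w_def cstar_mult mult.assoc)
    also have "\<dots> = cstar (D s * K s) * (D s * K s)"
      by (simp add: NN cstar_mult mult.assoc)
    finally have 1: "cstar (w s) * w s = 1" using K[OF s] by simp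
    have "N s * K s = K s * N s" using comK[OF _ s] com(1)[of "N s"] com(2)[of u] by simp
    then have "w s * cstar (w s) = K s * (N s * cstar (N s)) * cstar (K s)"
      by (simp add: w_def cstar_mult mult.assoc)
    also have "\<dots> = (K s * D s) * cstar (K s * D s)"
      by (simp add: NN cstar_mult mult.assoc)
    finally show "unitary (w s)" using 1 K[OF s] by (simp add: unitary_def)
    show "x * w s = w s * x" if "x * u = u * x" for x
      using com[OF that] comK[OF com(1)[OF that] s] by (simp add: w_def mult.assoc[symmetric]) (simp add: mult.assoc)
  qed
qed

text \<open>Half of 1 + u is within 1/2 of 1, hence invertible, and the Cayley path applies.\<close>

lemma unitary_path_near_1:
  fixes u :: "'a::cstar_algebra_1"
  assumes u: "unitary u" "norm (u - 1) \<le> 1"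
  obtains w where "continuous_on {0..1::real} w" "w 0 = 1" "w 1 = u"
    "\<And>s. s \<in> {0..1} \<Longrightarrow> unitary (w s)"
    "\<And>s x. s \<in> {0..1} \<Longrightarrow> x * u = u * x \<Longrightarrow> x * w s = w s * x"
proof -
  have "1 - (1 / 2) *\<^sub>R (1 + u) = - ((1 / 2) *\<^sub>R (u - 1))"
    by (simp add: algebra_simps scaleR_2[symmetric])
  then have "norm (1 - (1 / 2) *\<^sub>R (1 + u)) < 1" using u(2) by simp
  then obtain y where "y * ((1 / 2) *\<^sub>R (1 + u)) = 1" "((1 / 2) *\<^sub>R (1 + u)) * y = 1"
    by (rule neumann_inverse)
  then have "((1 / 2) *\<^sub>R y) * (1 + u) = 1" "(1 + u) * ((1 / 2) *\<^sub>R y) = 1" by auto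
  from unitary_path_Cayley[OF u(1) this] show ?thesis using that .
qed

lemma scalar_unitary:
  "cmod c = 1 \<Longrightarrow> unitary (c *\<^sub>C (1::'a::cstar_algebra_1))"
  by (simp add: unitary_def cstar_scaleC scaleC_mult_left scaleC_scaleC scaleC_one
      complex_norm_square[symmetric] mult.commute[of "cnj c"])

text \<open>The path below exists because the nearby unitary of the matrix algebra has finite spectrum, which
  misses a point of the circle, so that the Cayley path applies after a rotation.\<close>

context matrix_algebra
begin

lemma unitary_path_commuting_projection:
  assumes p: "projection p" "p \<in> F" and y: "unitary y" "p * y = y * p"
    and z: "z \<in> F" "norm (z - y) \<le> 1 / 16"
  obtains w where "continuous_on {0..1::real} w" "w 0 = 1" "w 1 = y"
    "\<And>s. s \<in> {0..1} \<Longrightarrow> unitary (w s)" "\<And>s. s \<in> {0..1} \<Longrightarrow> p * w s = w s * p"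
proof -
  note S = star_subalgebraD[OF star_subalgebra]
  define g0 where "g0 = 1 - 2 *\<^sub>R p"
  note g0 = projection_symmetry[OF p(1), folded g0_def]
  have comm: "p * x = x * p \<longleftrightarrow> g0 * x = x * g0" for x
    by (auto simp: g0_def algebra_simps)
  have g0F: "g0 \<in> F" using p S by (simp add: g0_def)
  \<comment> \<open>Averaging over the group {1, g0} makes z commute with g0 without leaving F. The
    distance to y does not grow, since y commutes with g0.\<close>
  define z1 where "z1 = (1 / 2) *\<^sub>R (z + g0 * z * g0)"
  have z1F: "z1 \<in> F" using S g0F z by (simp add: z1_def)
  have "g0 * z1 = (1 / 2) *\<^sub>R (g0 * z + (g0 * g0) * z * g0)"
    by (simp add: z1_def distrib_left mult.assoc)
  moreover have "z1 * g0 = (1 / 2) *\<^sub>R (z * g0 + g0 * z * (g0 * g0))"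
    by (simp add: z1_def distrib_right mult.assoc)
  ultimately have gz1: "g0 * z1 = z1 * g0" by (simp add: g0 add.commute)
  have gy: "g0 * y = y * g0" using y(2) comm by blast
  have "g0 * y * g0 = y" by (simp add: gy) (simp add: mult.assoc g0)
  then have "z1 - y = (1 / 2) *\<^sub>R ((z - y) + g0 * (z - y) * g0)"
    by (simp add: z1_def algebra_simps scaleR_2[symmetric])
  also have "norm \<dots> \<le> (1 / 2) * (norm (z - y) + norm (g0 * (z - y) * g0))"
    using norm_triangle_ineq by simp
  also have "norm (g0 * (z - y) * g0) \<le> norm g0 * norm (z - y) * norm g0"
    by (intro order_trans[OF norm_mult_ineq] mult_right_mono norm_mult_ineq) auto
  finally have z1y: "norm (z1 - y) \<le> 1 / 16" using z(2) unitary_norm[OF g0(3)] by simp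
  define s where "s = 1 - cstar z1 * z1"
  have s: "norm s \<le> 1 / 4" "norm s < 1"
    using almost_unitary_bounds(1)[OF y(1) z1y] by (auto simp: s_def)
  define z' where "z' = polar_part z1"
  have z'u: "unitary z'"
    unfolding z'_def by (rule polar_part_near_unitary[OF y(1)]) (use z1y in simp)
  have z'F: "z' \<in> F"
    unfolding z'_def using s(2) by (intro polar_part_in_star_subalgebra star_subalgebra closed_F z1F) (simp add: s_def)
  have gz1': "g0 * cstar z1 = cstar z1 * g0"
    using arg_cong[OF gz1, of cstar] by (simp add: cstar_mult g0)
  have gz': "g0 * z' = z' * g0"
    unfolding z'_def using s(2) by (intro polar_part_intertwine gz1 gz1') (simp add: s_def)
  have "norm z1 \<le> 17 / 16"
    using norm_triangle_ineq[of y "z1 - y"] z1y unitary_norm[OF y(1)] by simp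
  then have "norm (z1 * (inv_sqrt_one_minus s - 1)) \<le> (17 / 16) * (1 / 3)"
    using inv_sqrt_near_1[OF s(1)] by (intro order_trans[OF norm_mult_ineq] mult_mono) auto
  moreover have "norm (z' - y) = norm (z1 * (inv_sqrt_one_minus s - 1) + (z1 - y))"
    by (simp add: z'_def polar_part_def s_def algebra_simps)
  ultimately have z'y: "norm (z' - y) \<le> 1 / 2"
    using norm_triangle_ineq[of "z1 * (inv_sqrt_one_minus s - 1)" "z1 - y"] z1y by linarith
  obtain c k where c: "cmod c = 1" "k * (c *\<^sub>C 1 + z') = 1" "(c *\<^sub>C 1 + z') * k = 1"
    using z'F by (rule unimodular_resolvent)
  \<comment> \<open>The rotation takes -c, which is outside the spectrum of z', to -1; hence 1 + u1
    is invertible.\<close>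
  define u1 where "u1 = cnj c *\<^sub>C z'"
  have cc: "c * cnj c = 1" "cnj c * c = 1"
    using c(1) by (simp_all add: complex_norm_square[symmetric] mult.commute[of "cnj c"])
  have u1: "unitary u1"
    using unitary_mult[OF scalar_unitary[of "cnj c"] z'u] c(1) by (simp add: u1_def scaleC_mult_left)
  have "1 + u1 = cnj c *\<^sub>C (c *\<^sub>C 1 + z')"
    by (simp add: u1_def scaleC_add_right scaleC_scaleC cc scaleC_one)
  then have "(c *\<^sub>C k) * (1 + u1) = 1" "(1 + u1) * (c *\<^sub>C k) = 1"
    by (simp_all only: scaleC_mult_left scaleC_mult_right scaleC_scaleC cc c scaleC_one)
  then obtain w1 where w1: "continuous_on {0..1::real} w1" "w1 0 = 1" "w1 1 = u1"
    "\<And>s. s \<in> {0..1} \<Longrightarrow> unitary (w1 s)"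
    "\<And>s x. s \<in> {0..1} \<Longrightarrow> x * u1 = u1 * x \<Longrightarrow> x * w1 s = w1 s * x"
    by (rule unitary_path_Cayley[OF u1]) blast
  \<comment> \<open>The factorisation y = c u1 v splits y into a scalar, a unitary with a Cayley
    path and a unitary near 1. The final path is the product of the paths of the three factors, each
    of which commutes with p.\<close>
  define v where "v = cstar z' * y"
  have v: "unitary v" unfolding v_def by (intro unitary_mult unitary_cstar z'u y)
  have "v - 1 = - (cstar z' * (z' - y))"
    using z'u by (simp add: v_def algebra_simps unitary_def)
  then have "norm (v - 1) \<le> norm (cstar z') * norm (z' - y)"
    using norm_mult_ineq[of "cstar z'" "z' - y"] by simp
  then have "norm (v - 1) \<le> 1" using z'y unitary_norm[OF z'u] by simp
  with v obtain w2 where w2: "continuous_on {0..1::real} w2" "w2 0 = 1" "w2 1 = v"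
    "\<And>s. s \<in> {0..1} \<Longrightarrow> unitary (w2 s)"
    "\<And>s x. s \<in> {0..1} \<Longrightarrow> x * v = v * x \<Longrightarrow> x * w2 s = w2 s * x"
    by (rule unitary_path_near_1) blast
  obtain \<theta> where \<theta>: "c = cis \<theta>" using c(1) by (metis cis_Arg norm_eq_zero zero_neq_one sgn_if mult.left_neutral rcis_cmod_Arg rcis_def of_real_1)
  show ?thesis
  proof (rule that[of "\<lambda>s. cis (s * \<theta>) *\<^sub>C (w1 s * w2 s)"])
    have "continuous_on {0..1} (\<lambda>s. (cis (s * \<theta>) *\<^sub>C 1) * (w1 s * w2 s))"
      by (intro continuous_intros w1 w2 bounded_linear.continuous_on[OF bounded_linear_scaleC])
    then show "continuous_on {0..1} (\<lambda>s. cis (s * \<theta>) *\<^sub>C (w1 s * w2 s))"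
      by (simp add: scaleC_mult_left)
    show "cis (0 * \<theta>) *\<^sub>C (w1 0 * w2 0) = 1" by (simp add: w1 w2 scaleC_one)
    have "cis (1 * \<theta>) *\<^sub>C (w1 1 * w2 1) = c *\<^sub>C (cnj c *\<^sub>C z' * v)"
      by (simp add: w1 w2 u1_def \<theta>)
    also have "\<dots> = z' * v" by (simp add: scaleC_mult_left scaleC_scaleC cc scaleC_one)
    finally show "cis (1 * \<theta>) *\<^sub>C (w1 1 * w2 1) = y"
      using z'u by (simp add: v_def unitary_cancel)
  next
    fix s :: real assume s: "s \<in> {0..1}"
    have "unitary ((cis (s * \<theta>) *\<^sub>C 1) * (w1 s * w2 s))"
      by (intro unitary_mult scalar_unitary w1 w2 s) simp
    then show "unitary (cis (s * \<theta>) *\<^sub>C (w1 s * w2 s))"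
      by (simp add: scaleC_mult_left)
    have "g0 * u1 = u1 * g0" by (simp add: u1_def scaleC_mult_left scaleC_mult_right gz')
    then have 1: "g0 * w1 s = w1 s * g0" by (rule w1(5)[OF s])
    have "g0 * cstar z' = cstar z' * g0"
      using arg_cong[OF gz', of cstar] by (simp add: cstar_mult g0)
    then have "g0 * v = v * g0" using gy unfolding v_def by (metis mult.assoc)
    then have "g0 * w2 s = w2 s * g0" by (rule w2(5)[OF s])
    then have "g0 * (w1 s * w2 s) = (w1 s * w2 s) * g0" using 1 by (metis mult.assoc)
    then have "p * (w1 s * w2 s) = (w1 s * w2 s) * p" by (simp only: comm)
    then show "p * (cis (s * \<theta>) *\<^sub>C (w1 s * w2 s)) = (cis (s * \<theta>) *\<^sub>C (w1 s * w2 s)) * p"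
      by (simp add: scaleC_mult_left scaleC_mult_right)
  qed
qed

end

text \<open>Only the action of w between the corners at \<open>e 0 0\<close> and
  \<open>f 0 0\<close> matters; the sum copies it to every diagonal block. With f = e it turns a
  unitary commuting with \<open>e 0 0\<close> into an isometry commuting with all units.\<close>

lemma matrix_units_sandwich:
  assumes e: "matrix_units n e" and f: "matrix_units n f" and w: "f 0 0 * w = w * e 0 0"
    and ww: "cstar w * f 0 0 * w = e 0 0"
  defines "s \<equiv> \<Sum>i<n. f i 0 * w * e 0 i"
  shows "cstar s * s = 1" "\<And>j k. j < n \<Longrightarrow> k < n \<Longrightarrow> f j k * s = s * e j k"
proof -
  have n: "0 < n" by (rule matrix_units_pos[OF e])
  have cs: "cstar s = (\<Sum>i<n. e i 0 * cstar w * f 0 i)"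
    unfolding s_def cstar_sum
    by (intro sum.cong refl) (simp add: cstar_mult matrix_units_cstar[OF e] matrix_units_cstar[OF f] n mult.assoc)
  have "e i 0 * cstar w * f 0 i * (f j 0 * w * e 0 j) = (if i = j then e i i else 0)"
    if "i < n" "j < n" for i j
  proof -
    have "e i 0 * cstar w * f 0 i * (f j 0 * w * e 0 j) = e i 0 * cstar w * (f 0 i * f j 0) * w * e 0 j"
      by (simp add: mult.assoc)
    also have "\<dots> = (if i = j then e i 0 * (cstar w * f 0 0 * w) * e 0 j else 0)"
      using that n by (simp add: matrix_units_mult[OF f] mult.assoc)
    finally show ?thesis using that n by (simp add: ww matrix_units_mult[OF e])
  qed
  then have "cstar s * s = (\<Sum>i<n. \<Sum>j<n. if i = j then e i i else 0)"
    unfolding cs unfolding s_def sum_product by (intro sum.cong refl) auto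
  then show "cstar s * s = 1"
    by (simp add: matrix_units_sum[OF e])
  fix j k assume jk: "j < n" "k < n"
  have "f j k * s = (\<Sum>i<n. if i = k then f j 0 * w * e 0 k else 0)"
    unfolding s_def sum_distrib_left using jk n
    by (intro sum.cong refl) (simp add: mult.assoc[symmetric] matrix_units_mult[OF f])
  moreover have "s * e j k = (\<Sum>i<n. if i = j then f j 0 * w * e 0 k else 0)"
    unfolding s_def sum_distrib_right using jk n
    by (intro sum.cong refl) (simp add: mult.assoc matrix_units_mult[OF e])
  ultimately show "f j k * s = s * e j k" using jk by simp
qed

section \<open>Passage from matrix subalgebras to their limit\<close>

locale matricial_limit =
  fixes F :: "nat \<Rightarrow> 'a::cstar_algebra_1 set"
  assumes mono: "F k \<subseteq> F (Suc k)" and matricial: "\<exists>n. matrix_subalgebra (F k) n"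
    and dense: "closure (\<Union>k. F k) = UNIV"
begin

lemma F_mono: "k \<le> m \<Longrightarrow> F k \<subseteq> F m"
  using lift_Suc_mono_le[of F] mono by blast

text \<open>The lower bound m allows the approximant to be taken in a subalgebra that already
  contains given elements of \<open>F m\<close>.\<close>

lemma approx:
  fixes x :: 'a
  assumes "\<epsilon> > 0"
  obtains k a where "k \<ge> m" "a \<in> F k" "norm (a - x) < \<epsilon>"
proof -
  have "x \<in> closure (\<Union>k. F k)" using dense by simp
  then obtain a k where a: "a \<in> F k" "dist a x < \<epsilon>"
    using assms unfolding closure_approachable by blast
  then have "a \<in> F (max m k)" using F_mono[of k "max m k"] by auto
  then show ?thesis using that[of "max m k" a] a by (auto simp: dist_norm)
qed

lemma matrix_algebra_obtain:
  obtains n h where "matrix_algebra n h (F k)"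
  using matricial matrix_subalgebra_obtain by metis

lemma projection_conj_in_F:
  fixes p :: 'a
  assumes p: "projection p"
  obtains k u where "unitary u" "projection (cstar u * p * u)" "cstar u * p * u \<in> F k"
proof -
  obtain k a where a: "a \<in> F k" "norm (a - (1 - 2 *\<^sub>R p)) < 1 / 16"
    by (rule approx[of "1 / 16" 0 "1 - 2 *\<^sub>R p"]) auto
  obtain n h where "matrix_algebra n h (F k)" by (rule matrix_algebra_obtain)
  then interpret A: matrix_algebra n h "F k" .
  show ?thesis
    by (rule projection_near_closed_subalgebra[OF A.star_subalgebra A.closed_F p a(1) less_imp_le[OF a(2)]])
      (rule that)
qed

lemma isometry_unitary:
  fixes s :: 'a
  assumes "cstar s * s = 1"
  shows "unitary s"
proof -
  obtain k a where a: "a \<in> F k" "norm (a - s) < 1 / 4"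
    by (rule approx[of "1 / 4" 0 s]) auto
  obtain n h where "matrix_algebra n h (F k)" by (rule matrix_algebra_obtain)
  then interpret A: matrix_algebra n h "F k" .
  show ?thesis using A.isometry_near_imp_unitary[OF assms a(1)] a(2) by simp
qed

lemma projections_comparable_limit:
  fixes p q :: 'a
  assumes p: "projection p" and q: "projection q"
  shows "\<exists>w. (cstar w * w = p \<and> q * w = w) \<or> (cstar w * w = q \<and> p * w = w)"
proof -
  obtain k u where u: "unitary u" "projection (cstar u * p * u)" "cstar u * p * u \<in> F k"
    using p by (rule projection_conj_in_F)
  obtain l v where v: "unitary v" "projection (cstar v * q * v)" "cstar v * q * v \<in> F l"
    using q by (rule projection_conj_in_F)
  obtain n h where "matrix_algebra n h (F (max k l))" by (rule matrix_algebra_obtain)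
  then interpret A: matrix_algebra n h "F (max k l)" .
  have "cstar u * p * u \<in> F (max k l)" "cstar v * q * v \<in> F (max k l)"
    using u(3) v(3) F_mono[of k "max k l"] F_mono[of l "max k l"] by auto
  then obtain w where w: "(cstar w * w = cstar u * p * u \<and> cstar v * q * v * w = w) \<or>
      (cstar w * w = cstar v * q * v \<and> cstar u * p * u * w = w)"
    using A.projections_comparable u(2) v(2) by blast
  have *: "cstar (b * w * cstar a) * (b * w * cstar a) = p \<and> q * (b * w * cstar a) = b * w * cstar a"
    if a: "unitary a" and b: "unitary b" and w: "cstar w * w = cstar a * p * a" "cstar b * q * b * w = w"
    for a b w and p q :: 'a
  proof
    have "cstar (b * w * cstar a) * (b * w * cstar a) = a * (cstar w * ((cstar b * b) * w)) * cstar a"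
      by (simp add: cstar_mult cstar_cstar mult.assoc)
    also have "\<dots> = a * (cstar w * w) * cstar a"
      using b by (simp add: unitary_def)
    also have "\<dots> = (a * cstar a) * p * (a * cstar a)"
      by (simp add: w mult.assoc)
    finally show "cstar (b * w * cstar a) * (b * w * cstar a) = p" using a by (simp add: unitary_def)
    have "b * w = q * (b * w)"
      using arg_cong[OF w(2), of "\<lambda>x. b * x"] b by (simp add: mult.assoc unitary_cancel)
    then show "q * (b * w * cstar a) = b * w * cstar a" by (metis mult.assoc)
  qed
  show ?thesis
    using w *[OF u(1) v(1)] *[OF v(1) u(1)] by blast
qed

text \<open>Comparability gives a partial isometry in one direction only, possibly not onto. The
  sandwich still produces an isometry intertwining the two systems, which finiteness makes unitary;
  the other direction is turned around by taking adjoints.\<close>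

lemma matrix_units_unitarily_equivalent:
  fixes e f :: "nat \<Rightarrow> nat \<Rightarrow> 'a"
  assumes e: "matrix_units n e" and f: "matrix_units n f"
  obtains u where "unitary u" "\<And>i j. i < n \<Longrightarrow> j < n \<Longrightarrow> e i j * u = u * f i j"
proof -
  have n: "0 < n" by (rule matrix_units_pos[OF e])
  have main: "\<exists>u. unitary u \<and> (\<forall>i<n. \<forall>j<n. f i j * u = u * e i j)"
    if e: "matrix_units n e" and f: "matrix_units n f" and w: "cstar w * w = e 0 0" "f 0 0 * w = w"
    for e f :: "nat \<Rightarrow> nat \<Rightarrow> 'a" and w
  proof -
    have "e 0 0 * e 0 0 = e 0 0" "cstar (e 0 0) = e 0 0"
      using n by (simp_all add: matrix_units_mult[OF e] matrix_units_cstar[OF e])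
    \<comment> \<open>Because \<open>cstar w * w\<close> is \<open>e 0 0\<close>, all four terms of
      this square equal \<open>e 0 0\<close> up to sign and cancel; so w is supported on
      \<open>e 0 0\<close>.\<close>
    then have "cstar (w - w * e 0 0) * (w - w * e 0 0) = 0"
      using w(1) by (simp add: cstar_diff cstar_mult algebra_simps) (simp add: mult.assoc[symmetric] w(1))
    then have "w * e 0 0 = w" using eq_zero_if_cstar_mult_zero by fastforce
    then have s: "cstar (\<Sum>i<n. f i 0 * w * e 0 i) * (\<Sum>i<n. f i 0 * w * e 0 i) = 1"
      "\<And>j k. j < n \<Longrightarrow> k < n \<Longrightarrow> f j k * (\<Sum>i<n. f i 0 * w * e 0 i) = (\<Sum>i<n. f i 0 * w * e 0 i) * e j k"
      using matrix_units_sandwich[OF e f, of w] w by (simp_all add: mult.assoc)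
    then show ?thesis using isometry_unitary by blast
  qed
  have flip: "e i j * cstar u = cstar u * f i j" if "unitary u" "f i j * u = u * e i j" for u i j
    using that by (metis mult.assoc mult.left_neutral mult.right_neutral unitaryD)
  obtain w where "(cstar w * w = e 0 0 \<and> f 0 0 * w = w) \<or> (cstar w * w = f 0 0 \<and> e 0 0 * w = w)"
    using projections_comparable_limit projection_matrix_unit[OF e n] projection_matrix_unit[OF f n] by blast
  then consider u where "unitary u" "\<forall>i<n. \<forall>j<n. f i j * u = u * e i j" |
      u where "unitary u" "\<forall>i<n. \<forall>j<n. e i j * u = u * f i j"
    using main[OF e f] main[OF f e] by blast
  then show ?thesis
    by cases (use that flip unitary_cstar in blast)+
qed

lemma unitary_path_commuting_projection_limit:
  fixes p y :: 'a
  assumes p: "projection p" and y: "unitary y" "p * y = y * p"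
  obtains w where "continuous_on {0..1::real} w" "w 0 = 1" "w 1 = y"
    "\<And>s. s \<in> {0..1} \<Longrightarrow> unitary (w s)" "\<And>s. s \<in> {0..1} \<Longrightarrow> p * w s = w s * p"
proof -
  obtain k u where u: "unitary u" "projection (cstar u * p * u)" "cstar u * p * u \<in> F k"
    using p by (rule projection_conj_in_F)
  define y' where "y' = cstar u * y * u"
  obtain l z where z: "l \<ge> k" "z \<in> F l" "norm (z - y') < 1 / 16"
    using approx[of "1 / 16" k y'] by auto
  obtain n h where "matrix_algebra n h (F l)" by (rule matrix_algebra_obtain)
  then interpret A: matrix_algebra n h "F l" .
  have pl: "cstar u * p * u \<in> F l" using u(3) F_mono[OF z(1)] by blast
  have y': "unitary y'" unfolding y'_def by (intro unitary_mult unitary_cstar u y)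
  have py': "cstar u * p * u * y' = y' * (cstar u * p * u)"
    unfolding y'_def using y(2) u(1) by (simp add: mult.assoc unitary_cancel) (simp add: mult.assoc[symmetric])
  obtain w where w: "continuous_on {0..1::real} w" "w 0 = 1" "w 1 = y'"
    "\<And>s. s \<in> {0..1} \<Longrightarrow> unitary (w s)"
    "\<And>s. s \<in> {0..1} \<Longrightarrow> cstar u * p * u * w s = w s * (cstar u * p * u)"
    by (rule A.unitary_path_commuting_projection[OF u(2) pl y' py' z(2)]) (use z(3) in auto)
  show ?thesis
  proof (rule that[of "\<lambda>s. u * w s * cstar u"])
    show "continuous_on {0..1} (\<lambda>s. u * w s * cstar u)" by (intro continuous_intros w)
    show "u * w 0 * cstar u = 1" "u * w 1 * cstar u = y"
      using u(1) by (auto simp: w y'_def unitaryD mult.assoc unitary_cancel)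
  next
    fix s :: real assume s: "s \<in> {0..1}"
    show "unitary (u * w s * cstar u)" by (intro unitary_mult unitary_cstar u w s)
    have "p * (u * w s * cstar u) = u * (cstar u * p * u * w s) * cstar u"
      using u(1) by (simp add: mult.assoc unitary_cancel)
    also have "\<dots> = u * w s * cstar u * p"
      unfolding w(5)[OF s] using u(1) by (simp add: mult.assoc unitaryD)
    finally show "p * (u * w s * cstar u) = u * w s * cstar u * p" .
  qed
qed

text \<open>The commutant of the system is a diagonal copy of the corner at \<open>e 0 0\<close>, so
  a path commuting with this single projection can be copied to the diagonal. The end points are
  unchanged because 1 and y commute with all units.\<close>

lemma unitary_path_commuting_matrix_units:
  fixes e :: "nat \<Rightarrow> nat \<Rightarrow> 'a"
  assumes e: "matrix_units n e" and y: "unitary y" "\<And>i j. i < n \<Longrightarrow> j < n \<Longrightarrow> e i j * y = y * e i j"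
  obtains w where "continuous_on {0..1::real} w" "w 0 = 1" "w 1 = y"
    "\<And>s. s \<in> {0..1} \<Longrightarrow> unitary (w s)"
    "\<And>s i j. s \<in> {0..1} \<Longrightarrow> i < n \<Longrightarrow> j < n \<Longrightarrow> e i j * w s = w s * e i j"
proof -
  have n: "0 < n" by (rule matrix_units_pos[OF e])
  obtain w where w: "continuous_on {0..1::real} w" "w 0 = 1" "w 1 = y"
    "\<And>s. s \<in> {0..1} \<Longrightarrow> unitary (w s)" "\<And>s. s \<in> {0..1} \<Longrightarrow> e 0 0 * w s = w s * e 0 0"
    using unitary_path_commuting_projection_limit[OF projection_matrix_unit[OF e n] y(1) y(2)[OF n n]] by blast
  define W where "W s = (\<Sum>i<n. e i 0 * w s * e 0 i)" for s
  have W: "cstar (W s) * W s = 1" "\<And>j k. j < n \<Longrightarrow> k < n \<Longrightarrow> e j k * W s = W s * e j k"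
    if s: "s \<in> {0..1}" for s
  proof -
    have "cstar (w s) * e 0 0 * w s = e 0 0"
      using w(4)[OF s] w(5)[OF s] by (simp add: mult.assoc unitary_cancel)
    from matrix_units_sandwich[OF e e w(5)[OF s] this]
    show "cstar (W s) * W s = 1" "\<And>j k. j < n \<Longrightarrow> k < n \<Longrightarrow> e j k * W s = W s * e j k"
      by (simp_all add: W_def)
  qed
  show ?thesis
  proof (rule that[of W])
    show "continuous_on {0..1} W" unfolding W_def by (intro continuous_intros w)
    show "W 0 = 1" using n by (simp add: W_def w matrix_units_mult[OF e] matrix_units_sum[OF e])
    have "e i 0 * y * e 0 i = y * e i i" if "i < n" for i
      using y(2)[OF that n] that n by (simp add: mult.assoc matrix_units_mult[OF e])
    then show "W 1 = y" by (simp add: W_def w sum_distrib_left[symmetric] matrix_units_sum[OF e])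
  qed (use W isometry_unitary in auto)
qed

end

subsection \<open>Conjugation over a compact set of reals\<close>

text \<open>A self-adjoint \<open>y\<close> of norm less than 1 is the real part of the unitary
  \<open>y + \<i> (1 - y\<^sup>2)\<^sup>1\<^sup>/\<^sup>2\<close>, so it suffices that homomorphisms preserve unitaries.\<close>

lemma unital_star_hom_contractive:
  fixes h :: "'a::cstar_algebra_1 \<Rightarrow> 'b::cstar_algebra_1"
  assumes h: "unital_star_hom h"
  shows "norm (h x) \<le> norm x"
proof -
  have add: "h (x + y) = h x + h y" and mult: "h (x * y) = h x * h y"
    and star: "h (cstar x) = cstar (h x)" and one: "h 1 = 1" and smult: "h (c *\<^sub>C x) = c *\<^sub>C h x" for x y c
    using h by (auto simp: unital_star_hom_def)
  have smultR: "h (r *\<^sub>R x) = r *\<^sub>R h x" for r x by (simp add: scaleR_scaleC smult)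
  have contr: "norm (h y) \<le> 1" if y: "cstar y = y" "norm y < 1" for y
  proof -
    have s: "norm (y * y) < 1"
      using norm_mult_ineq[of y y] mult_strict_mono[of "norm y" 1 "norm y" 1] y(2) by simp
    \<comment> \<open>This is (1 - y^2)^(1/2), obtained as 1 - y^2 times its inverse square
      root.\<close>
    define z where "z = (1 - y * y) * inv_sqrt_one_minus (y * y)"
    have Rsa: "cstar (inv_sqrt_one_minus (y * y)) = inv_sqrt_one_minus (y * y)"
      by (simp add: cstar_inv_sqrt s cstar_mult y)
    have "(1 - y * y) * inv_sqrt_one_minus (y * y) = inv_sqrt_one_minus (y * y) * (1 - y * y)"
      by (rule inv_sqrt_commute[OF s]) (simp add: algebra_simps)
    then have zsa: "cstar z = z"
      by (simp add: z_def cstar_mult cstar_diff Rsa y)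
    have "y * inv_sqrt_one_minus (y * y) = inv_sqrt_one_minus (y * y) * y"
      by (rule inv_sqrt_commute[OF s]) (simp add: mult.assoc)
    moreover have "y * (1 - y * y) = (1 - y * y) * y" by (simp add: algebra_simps)
    ultimately have yz: "y * z = z * y" unfolding z_def by (metis mult.assoc)
    have zz: "z * z = 1 - y * y"
      unfolding z_def using inv_sqrt_square_inverse(3)[OF s] by (metis mult.assoc mult.right_neutral)
    define u where "u = y + \<i> *\<^sub>C z"
    have cu: "cstar u = y - \<i> *\<^sub>C z"
      using scaleC_diff_left[of 0 \<i> z] by (simp add: u_def cstar_add cstar_scaleC y zsa)
    have "cstar u * u = y * y + \<i> *\<^sub>C (y * z - z * y) - (\<i> * \<i>) *\<^sub>C (z * z)"
      by (subst cu) (simp add: u_def algebra_simps scaleC_mult_left scaleC_mult_right scaleC_scaleC scaleC_diff_right scaleC_add_right yz)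
    also have "\<dots> = 1"
      using scaleC_diff_left[of 0 1 "z * z"] by (simp add: yz zz scaleC_one)
    finally have "cstar (h u) * h u = 1" by (simp add: star[symmetric] mult[symmetric] one)
    then have nu: "norm (h u) = 1" by (rule norm_isometry)
    have "y = (1 / 2) *\<^sub>R (u + cstar u)" unfolding cu by (simp add: u_def scaleR_2[symmetric])
    then have "h y = (1 / 2) *\<^sub>R (h u + cstar (h u))" by (metis add smultR star)
    then have "norm (h y) = norm (h u + cstar (h u)) / 2" by simp
    then show ?thesis using norm_triangle_ineq[of "h u" "cstar (h u)"] nu by simp
  qed
  have sa: "norm (h y) \<le> norm y" if y: "cstar y = y" for y
  proof (rule field_le_epsilon)
    fix \<epsilon> :: real assume \<epsilon>: "\<epsilon> > 0"
    define r where "r = norm y + \<epsilon>"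
    have r: "r > 0" "norm y < r" using \<epsilon> by (auto simp: r_def add_nonneg_pos)
    have "norm (h ((1 / r) *\<^sub>R y)) \<le> 1"
      by (rule contr) (use r y in \<open>auto simp: cstar_scaleR\<close>)
    then show "norm (h y) \<le> norm y + \<epsilon>" using r by (simp add: smultR r_def[symmetric])
  qed
  have "(norm (h x))\<^sup>2 = norm (h (cstar x * x))" by (simp add: cstar_identity[symmetric] star mult)
  also have "\<dots> \<le> norm (cstar x * x)" by (rule sa) (simp add: cstar_mult cstar_cstar)
  finally show ?thesis by (simp add: cstar_identity power2_le_iff_abs_le)
qed

lemma compact_Inf_Sup:
  fixes X :: "real set"
  assumes X: "compact X" "X \<noteq> {}"
  shows "Inf X \<in> X" "Sup X \<in> X" "t \<in> X \<Longrightarrow> Inf X \<le> t" "t \<in> X \<Longrightarrow> t \<le> Sup X"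
proof -
  note bd = bounded_imp_bdd_below[OF compact_imp_bounded[OF X(1)]]
    bounded_imp_bdd_above[OF compact_imp_bounded[OF X(1)]] compact_imp_closed[OF X(1)]
  show "Inf X \<in> X" "Sup X \<in> X"
    using closed_contains_Inf[OF X(2) bd(1,3)] closed_contains_Sup[OF X(2) bd(2,3)] .
  show "t \<in> X \<Longrightarrow> Inf X \<le> t" "t \<in> X \<Longrightarrow> t \<le> Sup X"
    by (simp_all add: cInf_lower[OF _ bd(1)] cSup_upper[OF _ bd(2)])
qed

section \<open>Transport of matrix units along X\<close>

context matricial_limit
begin

text \<open>X is exhausted by windows starting at a. If the least point q of X in the next window is
  its left end c, continuity prescribes the value there; otherwise X has a gap before q and any
  unitary relating the systems at a and q may be used.\<close>

lemma matrix_units_transport: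
  fixes e :: "nat \<Rightarrow> nat \<Rightarrow> real \<Rightarrow> 'a"
  assumes X: "compact X" "X \<noteq> {}" and a: "a = Inf X"
    and cont: "\<And>i j. i < n \<Longrightarrow> j < n \<Longrightarrow> continuous_on X (e i j)"
    and e: "\<And>t. t \<in> X \<Longrightarrow> matrix_units n (\<lambda>i j. e i j t)"
  obtains w where "continuous_on X w" "\<And>t. t \<in> X \<Longrightarrow> unitary (w t)" "w a = 1"
    "\<And>t i j. t \<in> X \<Longrightarrow> i < n \<Longrightarrow> j < n \<Longrightarrow> e i j a * w t = w t * e i j t"
proof -
  have aX: "a \<in> X" and a_le: "\<And>t. t \<in> X \<Longrightarrow> a \<le> t"
    using compact_Inf_Sup[OF X] by (auto simp: a)
  have n: "0 < n" using matrix_units_pos[OF e[OF aX]] .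
  \<comment> \<open>This intertwines the systems at s and t exactly for all s and t. It is 1 on the
    diagonal, so uniform continuity keeps it within 1/4 of 1 for close s and t.\<close>
  define x where "x s t = (\<Sum>i<n. e i 0 s * e 0 i t)" for s t
  have xdiag: "x s s = 1" if "s \<in> X" for s
    using matrix_units_mult[OF e[OF that]] matrix_units_sum[OF e[OF that]] n by (simp add: x_def)
  have "continuous_on (X \<times> X) (\<lambda>z. norm (x (fst z) (snd z) - 1))"
    unfolding x_def
    by (intro continuous_intros continuous_on_compose2[OF cont continuous_on_fst[OF continuous_on_id]]
        continuous_on_compose2[OF cont continuous_on_snd[OF continuous_on_id]]) (use n in auto)
  then have "uniformly_continuous_on (X \<times> X) (\<lambda>z. norm (x (fst z) (snd z) - 1))"
    by (intro compact_uniformly_continuous compact_Times X)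
  then obtain \<delta> where \<delta>: "\<delta> > 0" "\<And>z z'. z \<in> X \<times> X \<Longrightarrow> z' \<in> X \<times> X \<Longrightarrow> dist z' z < \<delta> \<Longrightarrow>
      dist (norm (x (fst z') (snd z') - 1)) (norm (x (fst z) (snd z) - 1)) < 1 / 4"
    unfolding uniformly_continuous_on_def by (metis zero_less_divide_1_iff zero_less_numeral)
  have near: "norm (x s t - 1) \<le> 1 / 4" if "s \<in> X" "t \<in> X" "\<bar>t - s\<bar> < \<delta>" for s t
    using \<delta>(2)[of "(s, s)" "(s, t)"] that xdiag[OF that(1)] by (simp add: dist_Pair_Pair dist_real_def)
  define U where "U s t = polar_part (x s t)" for s t
  have U: "unitary (U s t)" "\<And>i j. i < n \<Longrightarrow> j < n \<Longrightarrow> e i j s * U s t = U s t * e i j t"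
    if st: "s \<in> X" "t \<in> X" "\<bar>t - s\<bar> < \<delta>" for s t
  proof -
    show "unitary (U s t)" unfolding U_def by (rule polar_part_near_1(1)[OF near[OF st]])
    fix i j assume ij: "i < n" "j < n"
    have int: "e i j s * x s t = x s t * e i j t" if "i < n" "j < n" for i j
    proof -
      have "e i j s * x s t = (\<Sum>k<n. if k = j then e i 0 s * e 0 j t else 0)"
        unfolding x_def sum_distrib_left using that n
        by (intro sum.cong refl) (simp add: mult.assoc[symmetric] matrix_units_mult[OF e[OF st(1)]])
      moreover have "x s t * e i j t = (\<Sum>k<n. if k = i then e i 0 s * e 0 j t else 0)"
        unfolding x_def sum_distrib_right using that n
        by (intro sum.cong refl) (simp add: mult.assoc matrix_units_mult[OF e[OF st(2)]])
      ultimately show ?thesis using that by simp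
    qed
    have "e i j t * cstar (x s t) = cstar (x s t) * e i j s"
      using arg_cong[OF int[OF ij(2,1)], of cstar] ij
      by (simp add: cstar_mult matrix_units_cstar[OF e[OF st(1)]] matrix_units_cstar[OF e[OF st(2)]])
    then show "e i j s * U s t = U s t * e i j t"
      unfolding U_def by (intro polar_part_near_1(2)[OF near[OF st]] int ij)
  qed
  define good where "good w Y \<longleftrightarrow> continuous_on Y w \<and> (\<forall>t\<in>Y. unitary (w t) \<and>
     (\<forall>i<n. \<forall>j<n. e i j a * w t = w t * e i j t)) \<and> w a = 1" for w Y
  \<comment> \<open>Points of a closed window of length d are then at distance strictly below
    \<delta>.\<close>
  define d where "d = \<delta> / 2"
  have d: "d > 0" "d < \<delta>" using \<delta>(1) by (auto simp: d_def)
  have step: "\<exists>w. good w (X \<inter> {..a + real k * d})" for k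
  proof (induction k)
    case 0
    have "X \<inter> {..a + real 0 * d} = {a}" using aX a_le by force
    then show ?case by (intro exI[of _ "\<lambda>_. 1"]) (simp add: good_def)
  next
    case (Suc k)
    define c where "c = a + real k * d"
    have Suc_c: "a + real (Suc k) * d = c + d" by (simp add: c_def algebra_simps)
    obtain w where w: "good w (X \<inter> {..c})" using Suc by (auto simp: c_def)
    define Z where "Z = X \<inter> {c..c + d}"
    have un: "X \<inter> {..c + d} = (X \<inter> {..c}) \<union> Z" using d by (auto simp: Z_def)
    show ?case
    proof (cases "Z = {}")
      case True
      then show ?thesis unfolding Suc_c un using w by auto
    next
      case False
      have clX: "closed X" using X compact_imp_closed by blast
      have clZ: "closed Z" unfolding Z_def by (intro closed_Int clX) simp
      define q where "q = Inf Z"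
      have bZ: "bdd_below Z" by (auto simp: Z_def intro!: bdd_belowI[of _ c])
      have qZ: "q \<in> Z" unfolding q_def by (rule closed_contains_Inf[OF False bZ clZ])
      have q_le: "q \<le> t" if "t \<in> Z" for t unfolding q_def by (rule cInf_lower[OF that bZ])
      have qX: "q \<in> X" and cq: "c \<le> q" using qZ by (auto simp: Z_def)
      obtain v where v: "unitary v" "\<And>i j. i < n \<Longrightarrow> j < n \<Longrightarrow> e i j a * v = v * e i j q" "q \<le> c \<Longrightarrow> v = w q"
      proof (cases "q \<le> c")
        case True
        then show ?thesis using that[of "w q"] w qX by (auto simp: good_def)
      next
        case False
        obtain v where "unitary v" "\<And>i j. i < n \<Longrightarrow> j < n \<Longrightarrow> e i j a * v = v * e i j q"
          using matrix_units_unitarily_equivalent[OF e[OF aX] e[OF qX]] by blast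
        then show ?thesis using that[of v] False by blast
      qed
      have nearZ: "t \<in> X \<and> \<bar>t - q\<bar> < \<delta>" if "t \<in> Z" for t
        using q_le[OF that] that d cq by (auto simp: Z_def)
      define w' where "w' t = (if t \<le> c then w t else v * U q t)" for t
      have "continuous_on ((X \<inter> {..c}) \<union> Z) w'"
        unfolding w'_def
      proof (rule continuous_on_If)
        show "continuous_on (X \<inter> {..c}) w" using w by (simp add: good_def)
        have "continuous_on Z (x q)"
          unfolding x_def using n
          by (intro continuous_intros continuous_on_subset[OF cont]) (auto simp: Z_def)
        then show "continuous_on Z (\<lambda>t. v * U q t)"
          unfolding U_def using nearZ near[OF qX] by (intro continuous_intros continuous_on_polar_part) auto
        \<comment> \<open>The pieces meet only at t = q = c, where \<open>U q q\<close> is 1 and v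
          was chosen as \<open>w q\<close>.\<close>
        show "w t = v * U q t" if "t \<in> Z" "t \<le> c" for t
        proof -
          have "t = q" using q_le[OF that(1)] cq that(2) by simp
          then show ?thesis using v(3) that(2) xdiag[OF qX] by (simp add: U_def)
        qed
      qed (use clX clZ in auto)
      moreover have "unitary (w' t) \<and> (\<forall>i<n. \<forall>j<n. e i j a * w' t = w' t * e i j t)"
        if t: "t \<in> (X \<inter> {..c}) \<union> Z" for t
      proof (cases "t \<le> c")
        case True
        then show ?thesis using t w by (auto simp: w'_def good_def Z_def)
      next
        case False
        then have tZ: "t \<in> Z" using t by auto
        note Ut = U[OF qX nearZ[OF tZ, THEN conjunct1] nearZ[OF tZ, THEN conjunct2]]
        have "e i j a * (v * U q t) = v * U q t * e i j t" if "i < n" "j < n" for i j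
          using v(2)[OF that] Ut(2)[OF that] by (metis mult.assoc)
        then show ?thesis using False Ut(1) v(1) by (simp add: w'_def unitary_mult)
      qed
      moreover have "w' a = 1" using w d by (simp add: w'_def good_def c_def)
      ultimately show ?thesis unfolding Suc_c un by (auto simp: good_def)
    qed
  qed
  obtain k :: nat where "(Sup X - a) / d < real k" using reals_Archimedean2 by blast
  then have "Sup X \<le> a + real k * d" using d by (simp add: field_simps)
  then have "X \<inter> {..a + real k * d} = X" using compact_Inf_Sup(4)[OF X] by force
  with step[of k] obtain w where "good w X" by auto
  then show ?thesis using that by (auto simp: good_def)
qed

text \<open>Both systems are transported to a and linked there by a unitary c, which is 1 if they
  agree at a. A factor v^* Y v with Y in the commutant of the system f at a commutes with f at every
  t, so it may be multiplied in without spoiling the conjugation; the end value y of Y is chosen to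
  cancel \<open>u0 b\<close>.\<close>

lemma matrix_units_conjugation:
  fixes e f :: "nat \<Rightarrow> nat \<Rightarrow> real \<Rightarrow> 'a"
  assumes X: "compact X" "X \<noteq> {}" and a: "a = Inf X" and b: "b = Sup X"
    and cont: "\<And>i j. i < n \<Longrightarrow> j < n \<Longrightarrow> continuous_on X (e i j)"
      "\<And>i j. i < n \<Longrightarrow> j < n \<Longrightarrow> continuous_on X (f i j)"
    and e: "\<And>t. t \<in> X \<Longrightarrow> matrix_units n (\<lambda>i j. e i j t)"
    and f: "\<And>t. t \<in> X \<Longrightarrow> matrix_units n (\<lambda>i j. f i j t)"
  obtains u where "continuous_on X u" "\<And>t. t \<in> X \<Longrightarrow> unitary (u t)"
    "\<And>t i j. t \<in> X \<Longrightarrow> i < n \<Longrightarrow> j < n \<Longrightarrow> e i j t * u t = u t * f i j t"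
    "(\<And>i j. i < n \<Longrightarrow> j < n \<Longrightarrow> e i j a = f i j a) \<Longrightarrow> u a = 1"
    "(\<And>i j. i < n \<Longrightarrow> j < n \<Longrightarrow> e i j b = f i j b) \<Longrightarrow> u b = 1"
proof -
  have aX: "a \<in> X" and bX: "b \<in> X" and le: "\<And>t. t \<in> X \<Longrightarrow> a \<le> t" "\<And>t. t \<in> X \<Longrightarrow> t \<le> b"
    using compact_Inf_Sup[OF X] by (auto simp: a b)
  obtain w where w: "continuous_on X w" "\<And>t. t \<in> X \<Longrightarrow> unitary (w t)" "w a = 1"
    "\<And>t i j. t \<in> X \<Longrightarrow> i < n \<Longrightarrow> j < n \<Longrightarrow> e i j a * w t = w t * e i j t"
    using matrix_units_transport[OF X a cont(1) e] by blast
  obtain v where v: "continuous_on X v" "\<And>t. t \<in> X \<Longrightarrow> unitary (v t)" "v a = 1"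
    "\<And>t i j. t \<in> X \<Longrightarrow> i < n \<Longrightarrow> j < n \<Longrightarrow> f i j a * v t = v t * f i j t"
    using matrix_units_transport[OF X a cont(2) f] by blast
  have flip: "y * cstar u = cstar u * x" if "unitary u" "x * u = u * y" for u x y :: 'a
    using that by (metis mult.assoc mult.left_neutral mult.right_neutral unitaryD)
  obtain c where c: "unitary c" "\<And>i j. i < n \<Longrightarrow> j < n \<Longrightarrow> e i j a * c = c * f i j a"
    "(\<And>i j. i < n \<Longrightarrow> j < n \<Longrightarrow> e i j a = f i j a) \<Longrightarrow> c = 1"
  proof (cases "\<forall>i<n. \<forall>j<n. e i j a = f i j a")
    case True
    then show ?thesis using that[of 1] by simp
  next
    case False
    obtain c where "unitary c" "\<And>i j. i < n \<Longrightarrow> j < n \<Longrightarrow> e i j a * c = c * f i j a"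
      using matrix_units_unitarily_equivalent[OF e[OF aX] f[OF aX]] by blast
    then show ?thesis using that[of c] False by blast
  qed
  define u0 where "u0 t = cstar (w t) * c * v t" for t
  have u0: "continuous_on X u0" unfolding u0_def by (intro continuous_intros w v)
  have u0u: "unitary (u0 t)" if "t \<in> X" for t
    unfolding u0_def by (intro unitary_mult unitary_cstar w v c that)
  have u0a: "u0 a = c" by (simp add: u0_def w v)
  have u0i: "e i j t * u0 t = u0 t * f i j t" if "t \<in> X" "i < n" "j < n" for t i j
    using flip[OF w(2)[OF that(1)] w(4)[OF that]] c(2)[OF that(2,3)] v(4)[OF that]
    unfolding u0_def by (metis mult.assoc)
  show ?thesis
  \<comment> \<open>The reparametrisation \<open>r\<close> below divides by b - a. For a = b,
    agreement at b is agreement at a, and \<open>u0\<close> already has the right value.\<close>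
  proof (cases "a < b \<and> (\<forall>i<n. \<forall>j<n. e i j b = f i j b)")
    case False
    show ?thesis
    proof (rule that[OF u0 u0u u0i])
      show "u0 a = 1" if "\<And>i j. i < n \<Longrightarrow> j < n \<Longrightarrow> e i j a = f i j a"
        using c(3)[OF that] u0a by simp
      show "u0 b = 1" if eq: "\<And>i j. i < n \<Longrightarrow> j < n \<Longrightarrow> e i j b = f i j b"
      proof -
        have "a = b" using False eq le[OF aX] by auto
        then show ?thesis using c(3) eq u0a by simp
      qed
    qed
  next
    case True
    define y where "y = v b * cstar (u0 b) * cstar (v b)"
    have y: "unitary y" unfolding y_def by (intro unitary_mult unitary_cstar v u0u bX)
    have fy: "f i j a * y = y * f i j a" if ij: "i < n" "j < n" for i j
    proof -
      have "f i j b * u0 b = u0 b * f i j b" using u0i[OF bX ij] True ij by simp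
      from flip[OF u0u[OF bX] this] flip[OF v(2)[OF bX] v(4)[OF bX ij]] v(4)[OF bX ij]
      show ?thesis unfolding y_def by (metis mult.assoc)
    qed
    obtain Y where Y: "continuous_on {0..1::real} Y" "Y 0 = 1" "Y 1 = y"
      "\<And>s. s \<in> {0..1} \<Longrightarrow> unitary (Y s)"
      "\<And>s i j. s \<in> {0..1} \<Longrightarrow> i < n \<Longrightarrow> j < n \<Longrightarrow> f i j a * Y s = Y s * f i j a"
      using unitary_path_commuting_matrix_units[OF f[OF aX] y fy] by blast
    define r where "r t = (t - a) / (b - a)" for t
    have r: "r t \<in> {0..1}" if "t \<in> X" for t
      using le[OF that] True by (simp add: r_def)
    define u where "u t = u0 t * (cstar (v t) * Y (r t) * v t)" for t
    show ?thesis
    proof (rule that[of u])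
      have "continuous_on X r" unfolding r_def using True by (intro continuous_intros) auto
      then have "continuous_on X (\<lambda>t. Y (r t))"
        by (rule continuous_on_compose2[OF Y(1)]) (use r in auto)
      then show "continuous_on X u" unfolding u_def by (intro continuous_intros u0 v)
      show "unitary (u t)" if "t \<in> X" for t
        unfolding u_def by (intro unitary_mult unitary_cstar u0u v Y r that)
      show "e i j t * u t = u t * f i j t" if t: "t \<in> X" "i < n" "j < n" for t i j
        using u0i[OF t] flip[OF v(2)[OF t(1)] v(4)[OF t]] Y(5)[OF r[OF t(1)] t(2,3)] v(4)[OF t]
        unfolding u_def by (metis mult.assoc)
      show "u a = 1" if "\<And>i j. i < n \<Longrightarrow> j < n \<Longrightarrow> e i j a = f i j a"
        using c(3)[OF that] by (simp add: u_def u0a v r_def Y)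
      have "r b = 1" using True by (simp add: r_def)
      then show "u b = 1"
        using v(2)[OF bX] u0u[OF bX] by (simp add: u_def Y y_def mult.assoc unitary_cancel unitaryD)
    qed
  qed
qed

text \<open>The matrix units span M, so intertwining them gives equality, not just approximation, on
  all of M.\<close>

lemma full_matrix_subalgebra_conjugation:
  fixes \<phi> \<psi> :: "'a \<Rightarrow> real \<Rightarrow> 'a"
  assumes X: "compact X" "X \<noteq> {}" and a: "a = Inf X" and b: "b = Sup X"
    and \<phi>: "unital_mono_C X \<phi>" and \<psi>: "unital_mono_C X \<psi>" and M: "matrix_subalgebra M n"
  shows "\<exists>u. cunitary X u \<and> (\<forall>x\<in>M. \<forall>t\<in>X. conj_by u (\<phi> x) t = \<psi> x t) \<and>
    ((\<forall>x\<in>M. \<phi> x a = \<psi> x a) \<longrightarrow> u a = 1) \<and> ((\<forall>x\<in>M. \<phi> x b = \<psi> x b) \<longrightarrow> u b = 1)"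
proof -
  obtain h where "matrix_algebra n h M" using M by (rule matrix_subalgebra_obtain)
  then interpret A: matrix_algebra n h M .
  have hom: "unital_star_hom (\<lambda>x. \<phi> x t)" "unital_star_hom (\<lambda>x. \<psi> x t)" if "t \<in> X" for t
    using \<phi> \<psi> that by (auto simp: unital_mono_C_def)
  have cont: "continuous_on X (\<phi> x)" "continuous_on X (\<psi> x)" for x
    using \<phi> \<psi> by (auto simp: unital_mono_C_def)
  obtain u where u: "continuous_on X u" "\<And>t. t \<in> X \<Longrightarrow> unitary (u t)"
    "\<And>t i j. t \<in> X \<Longrightarrow> i < n \<Longrightarrow> j < n \<Longrightarrow> \<phi> (A.g i j) t * u t = u t * \<psi> (A.g i j) t"
    "(\<And>i j. i < n \<Longrightarrow> j < n \<Longrightarrow> \<phi> (A.g i j) a = \<psi> (A.g i j) a) \<Longrightarrow> u a = 1"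
    "(\<And>i j. i < n \<Longrightarrow> j < n \<Longrightarrow> \<phi> (A.g i j) b = \<psi> (A.g i j) b) \<Longrightarrow> u b = 1"
    by (rule matrix_units_conjugation[OF X a b, of n "\<lambda>i j. \<phi> (A.g i j)" "\<lambda>i j. \<psi> (A.g i j)"])
      (auto intro: cont matrix_units_image[OF A.matrix_units_g hom(1)] matrix_units_image[OF A.matrix_units_g hom(2)])
  have expand: "H (h B) = (\<Sum>i<n. \<Sum>j<n. B $$ (i, j) *\<^sub>C H (A.g i j))"
    if H: "unital_star_hom H" and B: "B \<in> carrier_mat n n" for H :: "'a \<Rightarrow> 'a" and B
  proof -
    have add: "H (x + y) = H x + H y" and smult: "H (c *\<^sub>C x) = c *\<^sub>C H x" for x y c
      using H by (auto simp: unital_star_hom_def)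
    have zero: "H 0 = 0" using add[of 0 0] by simp
    have sum: "H (\<Sum>i\<in>I. f i) = (\<Sum>i\<in>I. H (f i))" for f :: "nat \<Rightarrow> 'a" and I
      by (induction I rule: infinite_finite_induct) (auto simp: add zero)
    show ?thesis unfolding A.h_expand[OF B] sum smult ..
  qed
  have "conj_by u (\<phi> x) t = \<psi> x t" if x: "x \<in> M" and t: "t \<in> X" for x t
  proof -
    obtain B where B: "B \<in> carrier_mat n n" "x = h B" using x A.mem_iff by blast
    have "\<phi> x t * u t = u t * \<psi> x t"
      unfolding B(2) expand[OF hom(1)[OF t] B(1)] expand[OF hom(2)[OF t] B(1)]
        sum_distrib_left sum_distrib_right
      by (intro sum.cong refl) (simp add: scaleC_mult_left scaleC_mult_right u(3)[OF t])
    then show ?thesis using u(2)[OF t] by (simp add: conj_by_def mult.assoc unitary_cancel)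
  qed
  moreover have "cunitary X u" using u(1,2) by (simp add: cunitary_def unitary_def)
  ultimately show ?thesis using u(4,5) A.g_mem by blast
qed

end

section \<open>The supremum norm over X and the limit argument\<close>

lemma cnorm_eq_0: "X \<noteq> {} \<Longrightarrow> (\<And>t. t \<in> X \<Longrightarrow> f t = 0) \<Longrightarrow> cnorm X f = 0"
  by (simp add: cnorm_def cong: SUP_cong_simp)

lemma cnorm_bounds:
  assumes "X \<noteq> {}" "\<And>t. t \<in> X \<Longrightarrow> norm (f t) \<le> B"
  shows "0 \<le> cnorm X f" "cnorm X f \<le> B"
proof -
  show "cnorm X f \<le> B" unfolding cnorm_def by (rule cSUP_least[OF assms])
  obtain t where t: "t \<in> X" using assms by blast
  have "bdd_above ((\<lambda>t. norm (f t)) ` X)" using assms(2) by (auto intro!: bdd_aboveI[of _ B])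
  then have "norm (f t) \<le> cnorm X f" unfolding cnorm_def by (rule cSUP_upper[OF t])
  then show "0 \<le> cnorm X f" using norm_ge_zero order_trans by blast
qed

text \<open>One sequence serves all four limit statements: \<open>u k\<close> conjugates exactly on
  \<open>F k\<close>, and it is 1 at an end point whenever the homomorphisms agree there. In the
  last statement the conjugation is exact, so the norm is 0 for every \<epsilon>.\<close>

theorem theorem3p3:
  fixes X :: "real set" and a b :: real
    and \<phi> \<psi> :: "'q::cstar_algebra_1 \<Rightarrow> real \<Rightarrow> 'q"
  assumes Q: "is_universal_UHF TYPE('q)"
    and X: "compact X" "X \<noteq> {}" "X \<subseteq> {0..1}"
    and ab: "a = Inf X" "b = Sup X"
    and \<phi>: "unital_mono_C X \<phi>" and \<psi>: "unital_mono_C X \<psi>"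
  shows
    "(\<exists>u :: nat \<Rightarrow> real \<Rightarrow> 'q. (\<forall>n. cunitary X (u n)) \<and>
        (\<forall>x. (\<lambda>n. cnorm X (\<lambda>t. conj_by (u n) (\<phi> x) t - \<psi> x t)) \<longlonglongrightarrow> 0))
   \<and> ((\<forall>x. \<phi> x a = \<psi> x a) \<longrightarrow>
       (\<exists>u :: nat \<Rightarrow> real \<Rightarrow> 'q. (\<forall>n. cunitary X (u n) \<and> u n a = 1) \<and>
          (\<forall>x. (\<lambda>n. cnorm X (\<lambda>t. conj_by (u n) (\<phi> x) t - \<psi> x t)) \<longlonglongrightarrow> 0)))
   \<and> ((\<forall>x. \<phi> x b = \<psi> x b) \<longrightarrow>
       (\<exists>u :: nat \<Rightarrow> real \<Rightarrow> 'q. (\<forall>n. cunitary X (u n) \<and> u n b = 1) \<and>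
          (\<forall>x. (\<lambda>n. cnorm X (\<lambda>t. conj_by (u n) (\<phi> x) t - \<psi> x t)) \<longlonglongrightarrow> 0)))
   \<and> ((\<forall>x. \<phi> x a = \<psi> x a) \<and> (\<forall>x. \<phi> x b = \<psi> x b) \<longrightarrow>
       (\<exists>u :: nat \<Rightarrow> real \<Rightarrow> 'q. (\<forall>n. cunitary X (u n) \<and> u n a = 1 \<and> u n b = 1) \<and>
          (\<forall>x. (\<lambda>n. cnorm X (\<lambda>t. conj_by (u n) (\<phi> x) t - \<psi> x t)) \<longlonglongrightarrow> 0)))
   \<and> (\<forall>F :: 'q set. full_matrix_subalgebra F \<and>
        (\<forall>f\<in>F. \<phi> f a = \<psi> f a) \<and> (\<forall>f\<in>F. \<phi> f b = \<psi> f b) \<longrightarrow>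
        (\<forall>\<epsilon>>0. \<exists>u :: real \<Rightarrow> 'q. cunitary X u \<and> u a = 1 \<and> u b = 1 \<and>
           (\<forall>f\<in>F. cnorm X (\<lambda>t. conj_by u (\<phi> f) t - \<psi> f t) < \<epsilon>)))"
proof -
  obtain F :: "nat \<Rightarrow> 'q set" where F: "\<And>k. F k \<subseteq> F (Suc k)"
    "\<And>k. matrix_subalgebra (F k) (fact k)" "closure (\<Union>k. F k) = UNIV"
    using Q unfolding is_universal_UHF_def by blast
  interpret Q: matricial_limit F by unfold_locales (use F in blast)+
  note conj = Q.full_matrix_subalgebra_conjugation[OF X(1,2) ab \<phi> \<psi>]
  have "\<forall>k. \<exists>u. cunitary X u \<and> (\<forall>x\<in>F k. \<forall>t\<in>X. conj_by u (\<phi> x) t = \<psi> x t) \<and>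
    ((\<forall>x\<in>F k. \<phi> x a = \<psi> x a) \<longrightarrow> u a = 1) \<and> ((\<forall>x\<in>F k. \<phi> x b = \<psi> x b) \<longrightarrow> u b = 1)"
    using conj[OF F(2)] by blast
  then obtain u where u: "\<And>k. cunitary X (u k)"
    "\<And>k x t. x \<in> F k \<Longrightarrow> t \<in> X \<Longrightarrow> conj_by (u k) (\<phi> x) t = \<psi> x t"
    "\<And>k. \<forall>x. \<phi> x a = \<psi> x a \<Longrightarrow> u k a = 1" "\<And>k. \<forall>x. \<phi> x b = \<psi> x b \<Longrightarrow> u k b = 1"
    by metis
  have hom: "unital_star_hom (\<lambda>x. \<phi> x t)" "unital_star_hom (\<lambda>x. \<psi> x t)" if "t \<in> X" for t
    using \<phi> \<psi> that by (auto simp: unital_mono_C_def)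
  have lim: "(\<lambda>n. cnorm X (\<lambda>t. conj_by (u n) (\<phi> x) t - \<psi> x t)) \<longlonglongrightarrow> 0" for x
  proof (rule LIMSEQ_I)
    fix \<epsilon> :: real assume \<epsilon>: "\<epsilon> > 0"
    \<comment> \<open>On y the conjugation is exact from k on, so only x - y contributes. Each
      homomorphism adds less than \<epsilon> / 3, and the bound 2 \<epsilon> / 3 stays below
      \<epsilon> after taking the supremum.\<close>
    obtain k y where y: "y \<in> F k" "norm (y - x) < \<epsilon> / 3"
      by (rule Q.approx[of "\<epsilon> / 3" 0 x]) (use \<epsilon> in auto)
    show "\<exists>N. \<forall>n\<ge>N. norm (cnorm X (\<lambda>t. conj_by (u n) (\<phi> x) t - \<psi> x t) - 0) < \<epsilon>"
    proof (intro exI[of _ k] allI impI)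
      fix n assume "n \<ge> k"
      then have yn: "y \<in> F n" using y(1) Q.F_mono by blast
      have bound: "norm (conj_by (u n) (\<phi> x) t - \<psi> x t) \<le> 2 * (\<epsilon> / 3)" if t: "t \<in> X" for t
      proof -
        have ut: "unitary (u n t)" using u(1) t by (auto simp: cunitary_def unitary_def)
        have \<phi>x: "\<phi> x t = \<phi> (x - y) t + \<phi> y t" and \<psi>x: "\<psi> x t = \<psi> (x - y) t + \<psi> y t"
          using hom[OF t] unfolding unital_star_hom_def by (metis diff_add_cancel)+
        have "conj_by (u n) (\<phi> x) t - \<psi> x t = cstar (u n t) * \<phi> (x - y) t * u n t - \<psi> (x - y) t"
          using u(2)[OF yn t] unfolding conj_by_def \<phi>x \<psi>x by (simp add: algebra_simps)
        also have "norm \<dots> \<le> norm (cstar (u n t) * \<phi> (x - y) t * u n t) + norm (\<psi> (x - y) t)"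
          by (rule norm_triangle_ineq4)
        also have "norm (cstar (u n t) * \<phi> (x - y) t * u n t) \<le> norm (cstar (u n t)) * norm (\<phi> (x - y) t) * norm (u n t)"
          by (intro order_trans[OF norm_mult_ineq] mult_right_mono norm_mult_ineq) auto
        also have "\<dots> = norm (\<phi> (x - y) t)" by (simp add: unitary_norm[OF ut])
        finally show ?thesis
          using unital_star_hom_contractive[OF hom(1)[OF t], of "x - y"]
            unital_star_hom_contractive[OF hom(2)[OF t], of "x - y"] y(2) norm_minus_commute[of x y] by linarith
      qed
      show "norm (cnorm X (\<lambda>t. conj_by (u n) (\<phi> x) t - \<psi> x t) - 0) < \<epsilon>"
        using cnorm_bounds[where f = "\<lambda>t. conj_by (u n) (\<phi> x) t - \<psi> x t", OF X(2) bound] \<epsilon> by simp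
    qed
  qed
  have fin: "\<exists>u. cunitary X u \<and> u a = 1 \<and> u b = 1 \<and> (\<forall>f\<in>M. cnorm X (\<lambda>t. conj_by u (\<phi> f) t - \<psi> f t) < \<epsilon>)"
    if M: "full_matrix_subalgebra M" "\<forall>f\<in>M. \<phi> f a = \<psi> f a" "\<forall>f\<in>M. \<phi> f b = \<psi> f b" and \<epsilon>: "\<epsilon> > 0" for M \<epsilon>
  proof -
    obtain n where n: "matrix_subalgebra M n" using M(1) unfolding full_matrix_subalgebra_def by blast
    obtain u where "cunitary X u" "\<And>x t. x \<in> M \<Longrightarrow> t \<in> X \<Longrightarrow> conj_by u (\<phi> x) t = \<psi> x t" "u a = 1" "u b = 1"
      using conj[OF n] M(2,3) by blast
    then show ?thesis using \<epsilon> by (intro exI[of _ u]) (auto simp: cnorm_eq_0[OF X(2)])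
  qed
  show ?thesis
    using u(1,3,4) lim fin by blast
qed

end
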